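(* Let $p>3$ be a prime with $\big(\frac p{31}\big)=1$. Then $$\sum_{k=0}^{[p/3]}\binom{3k}k(-1)^k\equiv\begin{cases}1\pmod p&\text{if }p=x^2+xy+70y^2,\ 9x^2+9xy+10y^2\text{ or }8x^2+3xy+9y^2,\\ (15x-14y)/(31y)\pmod p&\text{if }p=5x^2+xy+14y^2\neq5,\\ (21x-14y)/(31y)\pmod p&\text{if }p=7x^2+xy+10y^2\neq7,\\ (57x-8y)/(31y)\pmod p&\text{if }p=19x^2+5xy+4y^2\neq19,\\ -(105x+17y)/(31y)\pmod p&\text{if }p=35x^2+xy+2y^2,\end{cases}$$ where in each case $x,y\in\mathbb Z$.
   Context: $[x]$ is the greatest integer not exceeding $x$; $\big(\frac{\cdot}{\cdot}\big)$ is the Legendre symbol. Quotients are interpreted modulo $p$. *)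

theory Defs
  imports "HOL-Number_Theory.Number_Theory" "HOL-Number_Theory.Modular_Inverse"
begin

text \<open>
  The congruence \<open>s \<equiv> a / b (mod m)\<close>, with the quotient interpreted modulo \<open>m\<close>. Coprimality of the
  denominator with \<open>m\<close> is part of the assertion, because \<^const>\<open>modular_inverse\<close> has the junk
  value \<open>0\<close> for non-invertible arguments.
\<close>
definition cong_quotient :: "int \<Rightarrow> int \<Rightarrow> int \<Rightarrow> int \<Rightarrow> bool" where
  "cong_quotient s a b m \<longleftrightarrow> coprime b m \<and> [s = a * modular_inverse m b] (mod m)"

end

theory Submission
  imports Defs "HOL-Computational_Algebra.Polynomial"
begin

text \<open>
  Modulo \<open>p\<close> the sum equals \<open>\<Sum>k. (n + k choose 2k) 27\<^sup>k\<close> with \<open>n = \<lfloor>p/3\<rfloor>\<close>, which satisfies the recurrence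
  with characteristic polynomial \<open>t\<^sup>2 - 29 t + 1\<close>. If \<open>p\<close> is represented by the form
  \<open>A X\<^sup>2 + B X Y + C Y\<^sup>2\<close> of discriminant \<open>-279\<close>, then the roots of this polynomial in \<open>\<int>[\<omega>]/p\<close> are the
  quotients of \<open>z = A X + (B - 9)/2 Y - 9 Y \<omega>\<close> and its conjugate, so the sum is determined by
  the cubic residue symbol of \<open>z\<close> modulo \<open>p\<close>. By cubic reciprocity this is \<open>(p/z)\<^sub>3\<close>, and since the norm of
  \<open>z\<close> is \<open>A p - 9 Y\<^sup>2\<close>, it is the inverse of \<open>(A/z)\<^sub>3\<close>, which is found by reciprocity once more.

  Reciprocity between rational primes and Eisenstein integers is obtained from cubic Gauss sums,
  taken in the group ring \<open>\<int>[\<omega>][X]/(X\<^sup>q - 1)\<close> instead of a cyclotomic field. Unique factorisation in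
  \<open>\<int>[\<omega>]\<close> is not needed: a Jacobi sum of norm \<open>q\<close> splits off whenever \<open>q\<close> divides the norm.
\<close>

section \<open>Eisenstein integers\<close>

text \<open>The shape of \<open>z\<close> comes from
  \<open>4 A p = (2 A X + B Y)^2 + 279 Y^2\<close> with \<open>279 = 9 * 31\<close>. Modulo p the
  trace \<open>2 A X + B Y\<close> of \<open>z\<close> is Y times 3 sqrt(-31), while
  \<open>z\<close> minus its conjugate is -9 Y sqrt(-3). So their quotient is (sqrt(-31) - 3
  sqrt(-3)) / (sqrt(-31) + 3 sqrt(-3)), a root of t^2 - 29 t + 1. The coefficient 9 serves a second
  time: \<open>omega_char n\<close> depends only on n modulo 9, and this makes the symbol of
  \<open>9 Y^2\<close> trivial. Two things fail in the group ring that hold in a cyclotomic field: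
  the Gauss sum cannot be cancelled, and the sum of all X^a is not 0. The remedy is to carry one
  more factor of the Gauss sum, which annihilates that sum, and then to read off the coefficient at
  X, which is chi(1) = 1. Modulo a prime l dividing A, \<open>z\<close> is Y times
  \<open>h - 9 omega\<close>, so the symbol of A depends only on A and h, not on X and Y. In the
  final cases A is 1 or has only the prime factors 2, 5 and 7, and three small computations
  suffice.\<close>

text \<open>\<open>Eis a b\<close> stands for \<open>a + b \<omega>\<close>, where \<open>\<omega>\<close> is a primitive cube root of unity.\<close>

datatype eis = Eis (eis_fst: int) (eis_snd: int)

instantiation eis :: idom
begin

definition "0 = Eis 0 0"
definition "1 = Eis 1 0"
definition "x + y = Eis (eis_fst x + eis_fst y) (eis_snd x + eis_snd y)"
definition "x - y = Eis (eis_fst x - eis_fst y) (eis_snd x - eis_snd y)"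
definition "- x = Eis (- eis_fst x) (- eis_snd x)"
definition "x * y = Eis (eis_fst x * eis_fst y - eis_snd x * eis_snd y)
  (eis_fst x * eis_snd y + eis_snd x * eis_fst y - eis_snd x * eis_snd y)"

lemmas eis_defs = zero_eis_def one_eis_def plus_eis_def minus_eis_def uminus_eis_def times_eis_def

lemma eis_norm_form_eq_0_iff:
  fixes a b :: int
  shows "a\<^sup>2 - a * b + b\<^sup>2 = 0 \<longleftrightarrow> a = 0 \<and> b = 0"
proof
  assume "a\<^sup>2 - a * b + b\<^sup>2 = 0"
  then have "(2 * a - b)\<^sup>2 + 3 * b\<^sup>2 = 0"
    by (simp add: power2_eq_square algebra_simps)
  moreover have "(2 * a - b)\<^sup>2 \<ge> 0" "b\<^sup>2 \<ge> 0" by simp_all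
  ultimately have "(2 * a - b)\<^sup>2 = 0" "b\<^sup>2 = 0" by linarith+
  then show "a = 0 \<and> b = 0" by simp
qed simp

instance
proof
  fix x y z :: eis
  show "x * y * z = x * (y * z)" by (simp add: eis_defs algebra_simps)
  show "(x + y) * z = x * z + y * z" by (simp add: eis_defs algebra_simps)
  assume nz: "x \<noteq> 0" "y \<noteq> 0"
  obtain a b c d where xy: "x = Eis a b" "y = Eis c d" by (meson eis.exhaust)
  show "x * y \<noteq> 0"
  proof
    assume "x * y = 0"
    then have 1: "a * c - b * d = 0" and 2: "a * d + b * c - b * d = 0"
      by (simp_all add: eis_defs xy)
    have "(a\<^sup>2 - a * b + b\<^sup>2) * (c\<^sup>2 - c * d + d\<^sup>2)
      = (a * c - b * d)\<^sup>2 - (a * c - b * d) * (a * d + b * c - b * d) + (a * d + b * c - b * d)\<^sup>2"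
      by (simp add: power2_eq_square algebra_simps)
    with 1 2 have "(a\<^sup>2 - a * b + b\<^sup>2) * (c\<^sup>2 - c * d + d\<^sup>2) = 0" by simp
    then show False using nz by (auto simp: eis_norm_form_eq_0_iff xy eis_defs)
  qed
qed (simp_all add: eis_defs algebra_simps)

end

definition eis_omega :: eis (\<open>\<omega>\<close>) where "\<omega> = Eis 0 1"

definition eis_cnj :: "eis \<Rightarrow> eis" where
  "eis_cnj z = Eis (eis_fst z - eis_snd z) (- eis_snd z)"

definition eis_norm :: "eis \<Rightarrow> int" where
  "eis_norm z = (eis_fst z)\<^sup>2 - eis_fst z * eis_snd z + (eis_snd z)\<^sup>2"

definition cube_roots :: "eis set" where "cube_roots = {1, \<omega>, \<omega>\<^sup>2}"

lemma eis_sel_simps [simp]: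
  "eis_fst 0 = 0" "eis_snd 0 = 0" "eis_fst 1 = 1" "eis_snd 1 = 0"
  "eis_fst (x + y) = eis_fst x + eis_fst y" "eis_snd (x + y) = eis_snd x + eis_snd y"
  "eis_fst (x - y) = eis_fst x - eis_fst y" "eis_snd (x - y) = eis_snd x - eis_snd y"
  "eis_fst (- x) = - eis_fst x" "eis_snd (- x) = - eis_snd x"
  "eis_fst (x * y) = eis_fst x * eis_fst y - eis_snd x * eis_snd y"
  "eis_snd (x * y) = eis_fst x * eis_snd y + eis_snd x * eis_fst y - eis_snd x * eis_snd y"
  "eis_fst \<omega> = 0" "eis_snd \<omega> = 1"
  "eis_fst (eis_cnj x) = eis_fst x - eis_snd x" "eis_snd (eis_cnj x) = - eis_snd x"
  by (simp_all add: eis_defs eis_omega_def eis_cnj_def)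

lemma eis_of_nat_sel [simp]: "eis_fst (of_nat n) = int n" "eis_snd (of_nat n) = 0"
  by (induction n) auto

lemma eis_of_int_sel [simp]: "eis_fst (of_int n) = n" "eis_snd (of_int n) = 0"
  by (cases n; simp)+

lemma eis_numeral_sel [simp]: "eis_fst (numeral n) = numeral n" "eis_snd (numeral n) = 0"
  using eis_of_int_sel[of "numeral n"] by simp_all

lemma eis_eq_iff: "x = y \<longleftrightarrow> eis_fst x = eis_fst y \<and> eis_snd x = eis_snd y"
  by (auto intro: eis.expand)

lemma eis_cnj_simps [simp]:
  "eis_cnj 0 = 0" "eis_cnj 1 = 1" "eis_cnj (of_int n) = of_int n" "eis_cnj (eis_cnj x) = x"
  "eis_cnj (x + y) = eis_cnj x + eis_cnj y" "eis_cnj (x - y) = eis_cnj x - eis_cnj y"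
  "eis_cnj (x * y) = eis_cnj x * eis_cnj y" "eis_cnj \<omega> = \<omega>\<^sup>2" "eis_cnj (- x) = - eis_cnj x"
  by (simp_all add: eis_eq_iff power2_eq_square algebra_simps)

lemma eis_cnj_power [simp]: "eis_cnj (x ^ n) = eis_cnj x ^ n"
  by (induction n) auto

lemma eis_cnj_sum [simp]: "eis_cnj (sum f A) = (\<Sum>a\<in>A. eis_cnj (f a))"
  by (induction A rule: infinite_finite_induct) auto

lemma eis_mult_cnj: "x * eis_cnj x = of_int (eis_norm x)"
  by (simp add: eis_eq_iff eis_norm_def power2_eq_square algebra_simps)

lemma eis_norm_mult: "eis_norm (x * y) = eis_norm x * eis_norm y"
  by (simp add: eis_norm_def power2_eq_square algebra_simps)

lemma eis_norm_of_int [simp]: "eis_norm (of_int n) = n\<^sup>2"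
  by (simp add: eis_norm_def)

lemma eis_norm_of_nat [simp]: "eis_norm (of_nat n) = (int n)\<^sup>2"
  by (simp add: eis_norm_def)

lemma eis_norm_cnj [simp]: "eis_norm (eis_cnj x) = eis_norm x"
  by (simp add: eis_norm_def power2_eq_square algebra_simps)

lemma eis_norm_eq_0_iff: "eis_norm x = 0 \<longleftrightarrow> x = 0"
  by (simp add: eis_norm_def eis_norm_form_eq_0_iff eis_eq_iff)

lemma eis_norm_nonneg: "eis_norm x \<ge> 0"
proof -
  have "4 * eis_norm x = (2 * eis_fst x - eis_snd x)\<^sup>2 + 3 * (eis_snd x)\<^sup>2"
    by (simp add: eis_norm_def power2_eq_square algebra_simps)
  moreover have "(2 * eis_fst x - eis_snd x)\<^sup>2 \<ge> 0" "(eis_snd x)\<^sup>2 \<ge> 0" by simp_all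
  ultimately show ?thesis by linarith
qed

lemma of_int_dvd_eis_iff: "of_int n dvd x \<longleftrightarrow> n dvd eis_fst x \<and> n dvd eis_snd x"
proof
  assume "of_int n dvd x"
  then show "n dvd eis_fst x \<and> n dvd eis_snd x" by (auto elim!: dvdE)
next
  assume "n dvd eis_fst x \<and> n dvd eis_snd x"
  then obtain k l where "eis_fst x = n * k" "eis_snd x = n * l" by (auto elim!: dvdE)
  then have "x = of_int n * Eis k l" by (simp add: eis_eq_iff)
  then show "of_int n dvd x" by simp
qed

lemma of_int_dvd_of_int_eis_iff: "(of_int n :: eis) dvd of_int m \<longleftrightarrow> n dvd m"
  by (simp add: of_int_dvd_eis_iff)

lemma of_int_dvd_eis_cnj_iff: "of_int n dvd eis_cnj x \<longleftrightarrow> of_int n dvd x"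
  by (auto simp: of_int_dvd_eis_iff) (metis diff_add_cancel dvd_add)

text \<open>Multiplying by the conjugate of \<open>x\<close> replaces \<open>x\<close> by its norm,
  a rational integer that cancels coordinatewise. This stands in for invertibility modulo
  \<open>n\<close> throughout.\<close>

lemma of_int_dvd_eis_mult_cancel:
  assumes "of_int n dvd x * y" "coprime n (eis_norm x)"
  shows   "of_int n dvd y"
proof -
  have "of_int n dvd eis_cnj x * (x * y)" using assms(1) by (rule dvd_mult)
  also have "eis_cnj x * (x * y) = of_int (eis_norm x) * y"
    by (simp add: eis_mult_cnj [symmetric] mult_ac)
  finally show ?thesis using assms(2)
    by (auto simp: of_int_dvd_eis_iff coprime_dvd_mult_right_iff)
qed

lemma eis_omega_cubed: "\<omega> ^ 3 = 1"
  by (simp add: eis_eq_iff power3_eq_cube)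

lemma eis_omega_power_mod: "\<omega> ^ n = \<omega> ^ (n mod 3)"
proof -
  have "\<omega> ^ n = \<omega> ^ (3 * (n div 3) + n mod 3)" by simp
  also have "\<dots> = \<omega> ^ (n mod 3)" by (simp only: power_add power_mult eis_omega_cubed) simp
  finally show ?thesis .
qed

lemma eis_omega_power_cong: "n mod 3 = m mod 3 \<Longrightarrow> \<omega> ^ n = \<omega> ^ m"
  by (metis eis_omega_power_mod)

lemma one_in_cube_roots [simp]: "1 \<in> cube_roots"
  by (simp add: cube_roots_def)

lemma omega_power_in_cube_roots [simp]: "\<omega> ^ n \<in> cube_roots"
proof -
  have "n mod 3 = 0 \<or> n mod 3 = 1 \<or> n mod 3 = 2" by linarith
  then show ?thesis
    by (subst eis_omega_power_mod) (auto simp: cube_roots_def)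
qed

lemma cube_roots_mult: "u \<in> cube_roots \<Longrightarrow> v \<in> cube_roots \<Longrightarrow> u * v \<in> cube_roots"
  by (auto simp: cube_roots_def eis_eq_iff power2_eq_square)

lemma cube_roots_cubed: "u \<in> cube_roots \<Longrightarrow> u ^ 3 = 1"
  by (auto simp: cube_roots_def eis_eq_iff power2_eq_square power3_eq_cube)

lemma cube_roots_cnj: "u \<in> cube_roots \<Longrightarrow> eis_cnj u = u\<^sup>2"
  by (auto simp: cube_roots_def eis_eq_iff power2_eq_square)

lemma cube_roots_mult_cnj: "u \<in> cube_roots \<Longrightarrow> u * eis_cnj u = 1"
  using cube_roots_cnj[of u] cube_roots_cubed[of u] by (simp add: power2_eq_square power3_eq_cube mult.assoc)

lemma cube_roots_power_mod:
  assumes "u \<in> cube_roots"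
  shows   "u ^ n = u ^ (n mod 3)"
proof -
  have "u ^ n = u ^ (3 * (n div 3) + n mod 3)" by simp
  also have "\<dots> = u ^ (n mod 3)"
    by (simp only: power_add power_mult cube_roots_cubed[OF assms]) simp
  finally show ?thesis .
qed

lemma cube_roots_square_eq_1: "u \<in> cube_roots \<Longrightarrow> u\<^sup>2 = 1 \<Longrightarrow> u = 1"
  by (auto simp: cube_roots_def eis_eq_iff power2_eq_square)

text \<open>The difference of two distinct cube roots of unity always has a coordinate 1 or -1, so
  congruent roots are equal.\<close>

lemma cube_roots_eqI:
  assumes "u \<in> cube_roots" "v \<in> cube_roots" "of_int n dvd u - v" "\<bar>n\<bar> > 1"
  shows   "u = v"
proof -
  have "\<not> n dvd 1" "\<not> n dvd - 1" using assms(4) by auto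
  then show ?thesis
    using assms(1-3) by (auto simp: cube_roots_def of_int_dvd_eis_iff power2_eq_square)
qed

section \<open>Frobenius modulo a rational prime\<close>

lemma prime_dvd_power_add_diff:
  fixes x y :: "'a :: comm_ring_1"
  assumes "prime p"
  shows   "of_nat p dvd (x + y) ^ p - (x ^ p + y ^ p)"
proof -
  have p: "p > 0" using assms by (simp add: prime_gt_0_nat)
  have "(x + y) ^ p = (\<Sum>k\<le>p. of_nat (p choose k) * x ^ k * y ^ (p - k))"
    by (rule binomial_ring)
  also have "{..p} = insert 0 (insert p {0<..<p})" using p by auto
  also have "(\<Sum>k\<in>insert 0 (insert p {0<..<p}). of_nat (p choose k) * x ^ k * y ^ (p - k)) =
      y ^ p + x ^ p + (\<Sum>k\<in>{0<..<p}. of_nat (p choose k) * x ^ k * y ^ (p - k))"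
    using p by simp
  finally have "(x + y) ^ p - (x ^ p + y ^ p) =
      (\<Sum>k\<in>{0<..<p}. of_nat (p choose k) * x ^ k * y ^ (p - k))" by simp
  also have "of_nat p dvd \<dots>"
  proof (rule dvd_sum)
    fix k assume "k \<in> {0<..<p}"
    then have "p dvd p choose k"
      using assms by (intro dvd_choose_prime) auto
    then show "of_nat p dvd of_nat (p choose k) * x ^ k * y ^ (p - k)"
      by (auto elim!: dvdE)
  qed
  finally show ?thesis .
qed

lemma int_fermat_dvd:
  fixes c :: int
  assumes "prime p"
  shows   "int p dvd c ^ p - c"
proof (induction c rule: int_induct[where k = 0])
  case base
  show ?case using assms by (auto simp: power_0_left)
next
  case (step1 i)
  from dvd_add[OF prime_dvd_power_add_diff[OF assms, of i 1] step1(2)]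
  show ?case by (simp add: algebra_simps)
next
  case (step2 i)
  from dvd_diff[OF step2(2) prime_dvd_power_add_diff[OF assms, of "i - 1" 1]]
  show ?case by (simp add: algebra_simps)
qed

lemma eis_frobenius:
  assumes "prime p"
  shows "p mod 3 = 1 \<Longrightarrow> of_int (int p) dvd x ^ p - x"
    and "p mod 3 = 2 \<Longrightarrow> of_int (int p) dvd x ^ p - eis_cnj x"
proof -
  define a b where "a = eis_fst x" and "b = eis_snd x"
  have x: "x = of_int a + of_int b * \<omega>" by (simp add: a_def b_def eis_eq_iff)
  have 1: "of_int (int p) dvd x ^ p - (of_int a ^ p + (of_int b * \<omega>) ^ p)"
    using prime_dvd_power_add_diff[OF assms, of "of_int a" "of_int b * \<omega>"] by (simp add: x)
  have "of_int (int p) dvd (of_int (a ^ p - a) :: eis)"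
       "of_int (int p) dvd (of_int (b ^ p - b) :: eis)"
    using int_fermat_dvd[OF assms] by (simp_all only: of_int_dvd_of_int_eis_iff)
  then have 2: "of_int (int p) dvd of_int (a ^ p - a) + of_int (b ^ p - b) * \<omega> ^ p"
    by (simp only: dvd_add dvd_mult2)
  have 3: "of_int (int p) dvd x ^ p - (of_int a + of_int b * \<omega> ^ p)"
    using dvd_add[OF 1 2] by (simp add: algebra_simps power_mult_distrib)
  show "of_int (int p) dvd x ^ p - x" if "p mod 3 = 1"
    using 3 that by (simp add: eis_omega_power_mod[of p] x)
  show "of_int (int p) dvd x ^ p - eis_cnj x" if "p mod 3 = 2"
    using 3 that by (simp add: eis_omega_power_mod[of p] x)
qed

section \<open>The group ring of \<open>\<int>/q\<close> over the Eisenstein integers\<close>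

text \<open>The condition on \<open>h\<close> is injectivity modulo \<open>q\<close>, which on a
  finite set of residues already gives a bijection; no inverse map has to be supplied.\<close>

lemma sum_residues_reindex:
  fixes f :: "int \<Rightarrow> 'a :: comm_monoid_add" and q :: int
  assumes q: "q > 0" and f: "\<And>a. f (a mod q) = f a"
    and h: "\<And>a b. q dvd h a - h b \<Longrightarrow> q dvd a - b"
  shows "(\<Sum>a\<in>{0..<q}. f (h a)) = (\<Sum>a\<in>{0..<q}. f a)"
proof -
  have inj: "inj_on (\<lambda>a. h a mod q) {0..<q}"
  proof (rule inj_onI)
    fix a b assume ab: "a \<in> {0..<q}" "b \<in> {0..<q}" and "h a mod q = h b mod q"
    then have "q dvd a - b" using h by (simp add: mod_eq_dvd_iff)
    then have "a mod q = b mod q" by (simp add: mod_eq_dvd_iff)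
    then show "a = b" using ab by simp
  qed
  have "(\<lambda>a. h a mod q) ` {0..<q} = {0..<q}"
    by (rule endo_inj_surj) (use q inj in auto)
  with inj have "bij_betw (\<lambda>a. h a mod q) {0..<q} {0..<q}" by (simp add: bij_betw_def)
  from sum.reindex_bij_betw[OF this, of f] show ?thesis by (simp add: f)
qed

text \<open>Congruence modulo the ideal generated by X^q - 1 and \<open>n\<close>, that is,
  congruence modulo \<open>n\<close> in the group ring. With \<open>n = 0\<close> it is equality in
  the group ring.\<close>

definition gcong :: "nat \<Rightarrow> int \<Rightarrow> eis poly \<Rightarrow> eis poly \<Rightarrow> bool" where
  "gcong q n f g \<longleftrightarrow> (\<exists>u v. f - g = (monom 1 q - 1) * u + of_int n * v)"

lemma gcong_refl [simp]: "gcong q n f f"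
  unfolding gcong_def by (rule exI[of _ 0], rule exI[of _ 0]) simp

lemma gcong_sym: "gcong q n f g \<Longrightarrow> gcong q n g f"
  unfolding gcong_def
proof (elim exE)
  fix u v assume "f - g = (monom 1 q - 1) * u + of_int n * v"
  then have "g - f = (monom 1 q - 1) * (- u) + of_int n * (- v)" by (simp add: algebra_simps)
  then show "\<exists>u v. g - f = (monom 1 q - 1) * u + of_int n * v" by blast
qed

lemma gcong_add: "gcong q n f g \<Longrightarrow> gcong q n f' g' \<Longrightarrow> gcong q n (f + f') (g + g')"
  unfolding gcong_def
proof (elim exE)
  fix u v u' v'
  assume *: "f - g = (monom 1 q - 1) * u + of_int n * v" "f' - g' = (monom 1 q - 1) * u' + of_int n * v'"
  have "f + f' - (g + g') = (f - g) + (f' - g')" by simp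
  also have "\<dots> = (monom 1 q - 1) * (u + u') + of_int n * (v + v')"
    unfolding * by (simp only: distrib_left add_ac)
  finally show "\<exists>u v. f + f' - (g + g') = (monom 1 q - 1) * u + of_int n * v" by blast
qed

lemma gcong_mult_left: "gcong q n f g \<Longrightarrow> gcong q n (h * f) (h * g)"
  unfolding gcong_def
proof (elim exE)
  fix u v
  assume "f - g = (monom 1 q - 1) * u + of_int n * v"
  then have "h * f - h * g = (monom 1 q - 1) * (h * u) + of_int n * (h * v)"
    by (simp only: right_diff_distrib [symmetric]) (simp add: algebra_simps)
  then show "\<exists>u v. h * f - h * g = (monom 1 q - 1) * u + of_int n * v" by blast
qed

lemma gcong_trans [trans]: "gcong q n f g \<Longrightarrow> gcong q n g h \<Longrightarrow> gcong q n f h"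
  using gcong_add[of q n f g g h] unfolding gcong_def by (simp add: algebra_simps)

lemma gcong_mult: "gcong q n f g \<Longrightarrow> gcong q n f' g' \<Longrightarrow> gcong q n (f * f') (g * g')"
  by (metis gcong_mult_left gcong_trans mult.commute)

lemma gcong_smult: "gcong q n f g \<Longrightarrow> gcong q n (smult c f) (smult c g)"
  using gcong_mult_left[of q n f g "[:c:]"] by simp

lemma gcong_sum: "(\<And>a. a \<in> A \<Longrightarrow> gcong q n (f a) (g a)) \<Longrightarrow> gcong q n (sum f A) (sum g A)"
  by (induction A rule: infinite_finite_induct) (auto intro: gcong_add)

lemma gcong_dvdI: "of_int n dvd f - g \<Longrightarrow> gcong q n f g"
  unfolding gcong_def by (metis add_0 dvdE mult_zero_right)

text \<open>The coefficient at X after exponents are folded modulo \<open>q\<close>: a linear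
  functional that is well defined on the group ring. It sends the Gauss sum to 1, so a congruence
  between scalar multiples of the Gauss sum yields one between the scalars.\<close>

definition res_coeff :: "nat \<Rightarrow> eis poly \<Rightarrow> eis" where
  "res_coeff q f = (\<Sum>i\<le>degree f. if i mod q = 1 then coeff f i else 0)"

lemma res_coeff_eq:
  assumes "degree f \<le> m"
  shows "res_coeff q f = (\<Sum>i\<le>m. if i mod q = 1 then coeff f i else 0)"
  unfolding res_coeff_def
  by (rule sum.mono_neutral_left) (use assms in \<open>auto simp: coeff_eq_0\<close>)

lemma res_coeff_0 [simp]: "res_coeff q 0 = 0"
  by (simp add: res_coeff_def)

lemma res_coeff_add: "res_coeff q (f + g) = res_coeff q f + res_coeff q g"
proof -
  define m where "m = max (degree f) (degree g)"
  have "degree f \<le> m" "degree g \<le> m" "degree (f + g) \<le> m"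
    by (auto simp: m_def degree_add_le_max)
  then show ?thesis
    by (auto simp: res_coeff_eq[of _ m] sum.distrib [symmetric] intro!: sum.cong)
qed

lemma res_coeff_smult: "res_coeff q (smult c f) = c * res_coeff q f"
  by (subst res_coeff_eq[of _ "degree f"])
     (auto simp: res_coeff_def sum_distrib_left degree_smult_le intro!: sum.cong)

lemma res_coeff_diff: "res_coeff q (f - g) = res_coeff q f - res_coeff q g"
  using res_coeff_add[of q "f - g" g] by simp

lemma res_coeff_sum: "res_coeff q (sum f A) = (\<Sum>a\<in>A. res_coeff q (f a))"
  by (induction A rule: infinite_finite_induct) (auto simp: res_coeff_add)

lemma res_coeff_monom: "res_coeff q (monom c i) = (if i mod q = 1 then c else 0)"
proof -
  have "res_coeff q (monom c i) = (\<Sum>j\<le>i. if j mod q = 1 then coeff (monom c i) j else 0)"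
    by (rule res_coeff_eq) (simp add: degree_monom_le)
  also have "\<dots> = (\<Sum>j\<le>i. if j = i then (if i mod q = 1 then c else 0) else 0)"
    by (intro sum.cong) auto
  finally show ?thesis by simp
qed

lemma res_coeff_monom_mult: "res_coeff q (monom 1 q * f) = res_coeff q f"
proof -
  have *: "monom 1 q * f = (\<Sum>i\<le>degree f. monom (coeff f i) (q + i))"
    by (subst poly_as_sum_of_monoms [symmetric]) (simp add: sum_distrib_left mult_monom)
  have "res_coeff q (monom 1 q * f) = (\<Sum>i\<le>degree f. if i mod q = 1 then coeff f i else 0)"
    unfolding * by (simp add: res_coeff_sum res_coeff_monom)
  then show ?thesis by (simp add: res_coeff_def)
qed

lemma gcong_imp_res_coeff:
  assumes "gcong q n f g"
  shows   "of_int n dvd res_coeff q f - res_coeff q g"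
proof -
  from assms obtain u v where "f - g = (monom 1 q - 1) * u + of_int n * v"
    by (auto simp: gcong_def)
  then have "f - g = monom 1 q * u - u + smult (of_int n) v"
    by (simp add: algebra_simps of_int_poly)
  then have "res_coeff q f - res_coeff q g = of_int n * res_coeff q v"
    by (simp only: res_coeff_diff [symmetric])
       (simp add: res_coeff_add res_coeff_diff res_coeff_monom_mult res_coeff_smult)
  then show ?thesis by simp
qed

definition group_elem :: "nat \<Rightarrow> int \<Rightarrow> eis poly" where
  "group_elem q a = monom 1 (nat (a mod int q))"

definition group_sum :: "nat \<Rightarrow> (int \<Rightarrow> eis) \<Rightarrow> eis poly" where
  "group_sum q f = (\<Sum>a\<in>{0..<int q}. smult (f a) (group_elem q a))"

lemma group_elem_mod [simp]: "group_elem q (a mod int q) = group_elem q a"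
  by (simp add: group_elem_def)

lemma gcong_monom_mod: "gcong q n (monom 1 k) (monom 1 (k mod q))"
proof -
  have *: "gcong q n (monom 1 (q * j)) 1" for j
  proof (induction j)
    case (Suc j)
    have "gcong q n (monom 1 q) 1"
      unfolding gcong_def by (rule exI[of _ 1], rule exI[of _ 0]) simp
    from gcong_mult[OF this Suc] show ?case by (simp add: mult_monom)
  qed (simp add: monom_0 one_pCons)
  have "monom 1 k = monom 1 (q * (k div q)) * (monom 1 (k mod q) :: eis poly)"
    by (simp add: mult_monom)
  then show ?thesis
    using gcong_mult[OF *[of "k div q"] gcong_refl[of q n "monom 1 (k mod q)"]] by simp
qed

lemma gcong_group_elem_mult:
  assumes "q > 0"
  shows "gcong q n (group_elem q a * group_elem q b) (group_elem q (a + b))"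
proof -
  have "(nat (a mod int q) + nat (b mod int q)) mod q = nat ((a + b) mod int q)"
    using assms by (simp add: nat_add_distrib [symmetric] nat_mod_as_int mod_add_eq)
  then show ?thesis
    using gcong_monom_mod[of q n "nat (a mod int q) + nat (b mod int q)"]
    by (simp add: group_elem_def mult_monom)
qed

lemma gcong_group_elem_power:
  assumes "q > 0"
  shows "gcong q n (group_elem q a ^ k) (group_elem q (int k * a))"
proof (induction k)
  case 0
  show ?case by (simp add: group_elem_def monom_0 one_pCons)
next
  case (Suc k)
  have "gcong q n (group_elem q a ^ Suc k) (group_elem q a * group_elem q (int k * a))"
    using gcong_mult_left[OF Suc] by simp
  also have "gcong q n \<dots> (group_elem q (a + int k * a))"
    by (rule gcong_group_elem_mult) fact
  finally show ?case by (simp add: algebra_simps)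
qed

lemma res_coeff_group_sum:
  assumes "q > 1"
  shows   "res_coeff q (group_sum q f) = f 1"
proof -
  have "res_coeff q (group_sum q f) = (\<Sum>a\<in>{0..<int q}. if a = 1 then f 1 else 0)"
    unfolding group_sum_def res_coeff_sum res_coeff_smult
  proof (intro sum.cong refl)
    fix a assume "a \<in> {0..<int q}"
    moreover from this have "nat a mod q = nat a" by (simp add: nat_less_iff)
    ultimately show "f a * res_coeff q (group_elem q a) = (if a = 1 then f 1 else 0)"
      by (auto simp: group_elem_def res_coeff_monom)
  qed
  then show ?thesis using assms by simp
qed

lemma group_sum_smult: "smult c (group_sum q f) = group_sum q (\<lambda>a. c * f a)"
  using sum_distrib_left[of "[:c:]" "\<lambda>a. smult (f a) (group_elem q a)" "{0..<int q}"]
  by (simp add: group_sum_def mult.commute)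

lemma gcong_group_sum_mult:
  assumes q: "q > 0" and g: "\<And>a. g (a mod int q) = g a"
  shows "gcong q n (group_sum q f * group_sum q g)
    (group_sum q (\<lambda>c. \<Sum>a\<in>{0..<int q}. f a * g (c - a)))"
proof -
  let ?A = "{0..<int q}"
  have "group_sum q f * group_sum q g =
      (\<Sum>a\<in>?A. \<Sum>b\<in>?A. smult (f a * g b) (group_elem q a * group_elem q b))"
    by (simp add: group_sum_def sum_product mult.commute)
  also have "gcong q n \<dots> (\<Sum>a\<in>?A. \<Sum>b\<in>?A. smult (f a * g b) (group_elem q (a + b)))"
    by (intro gcong_sum gcong_smult gcong_group_elem_mult q)
  also have "(\<Sum>a\<in>?A. \<Sum>b\<in>?A. smult (f a * g b) (group_elem q (a + b))) =
      (\<Sum>a\<in>?A. \<Sum>c\<in>?A. smult (f a * g (c - a)) (group_elem q c))"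
  proof (rule sum.cong[OF refl])
    fix a
    define F where "F = (\<lambda>c. smult (f a * g (c - a)) (group_elem q c))"
    have "F (c mod int q) = F c" for c
      unfolding F_def by (metis g group_elem_mod mod_diff_left_eq)
    then have "(\<Sum>b\<in>?A. F (a + b)) = (\<Sum>c\<in>?A. F c)"
      using q by (intro sum_residues_reindex[where f = F and h = "\<lambda>b. a + b"]) auto
    then show "(\<Sum>b\<in>?A. smult (f a * g b) (group_elem q (a + b))) =
      (\<Sum>c\<in>?A. smult (f a * g (c - a)) (group_elem q c))" by (simp add: F_def)
  qed
  also have "\<dots> = group_sum q (\<lambda>c. \<Sum>a\<in>?A. f a * g (c - a))"
    unfolding group_sum_def by (subst sum.swap) (simp add: smult_sum)
  finally show ?thesis .
qed

lemma gcong_sum_power_prime: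
  assumes "prime p"
  shows "gcong q (int p) (sum f A ^ p) (\<Sum>a\<in>A. f a ^ p)"
proof (induction A rule: infinite_finite_induct)
  case (insert a A)
  have "gcong q (int p) ((f a + sum f A) ^ p) (f a ^ p + sum f A ^ p)"
    using prime_dvd_power_add_diff[OF assms, of "f a" "sum f A"] by (intro gcong_dvdI) simp
  also have "gcong q (int p) \<dots> (f a ^ p + (\<Sum>a\<in>A. f a ^ p))"
    by (intro gcong_add gcong_refl insert.IH)
  finally show ?case using insert by simp
qed (use assms in \<open>auto simp: power_0_left\<close>)

text \<open>Frobenius raises coefficients to the power \<open>p\<close> and multiplies exponents by
  \<open>p\<close>. Describing the result by \<open>g\<close> at the new exponent avoids naming an
  inverse of \<open>p\<close> modulo \<open>q\<close>.\<close>

lemma gcong_group_sum_power_prime: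
  assumes p: "prime p" and q: "q > 0" and pq: "coprime (int p) (int q)"
    and g: "\<And>a. g (a mod int q) = g a" and fg: "\<And>a. g (int p * a) = f a ^ p"
  shows "gcong q (int p) (group_sum q f ^ p) (group_sum q g)"
proof -
  let ?A = "{0..<int q}"
  have "gcong q (int p) (group_sum q f ^ p) (\<Sum>a\<in>?A. (smult (f a) (group_elem q a)) ^ p)"
    unfolding group_sum_def by (rule gcong_sum_power_prime) fact
  also have "gcong q (int p) \<dots> (\<Sum>a\<in>?A. smult (g (int p * a)) (group_elem q (int p * a)))"
    unfolding smult_power fg by (intro gcong_sum gcong_smult gcong_group_elem_power q)
  also have "(\<Sum>a\<in>?A. smult (g (int p * a)) (group_elem q (int p * a))) = group_sum q g"
    unfolding group_sum_def
  proof (rule sum_residues_reindex[where f = "\<lambda>a. smult (g a) (group_elem q a)"])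
    fix a b assume "int q dvd int p * a - int p * b"
    then have "int q dvd int p * (a - b)" by (simp add: algebra_simps)
    with pq show "int q dvd a - b" by (simp add: coprime_commute coprime_dvd_mult_right_iff)
  qed (use q g in auto)
  finally show ?thesis .
qed

section \<open>Cubic characters and Jacobi sums\<close>

text \<open>\<open>w\<close> is a primitive cube root of unity modulo \<open>q\<close>; choosing it
  selects one of the two prime ideals above \<open>q\<close>, hence one of two conjugate characters
  and Jacobi sums.\<close>

locale cubic_character =
  fixes q :: nat and w :: int
  assumes q_prime: "prime q" and q_mod_3: "q mod 3 = 1" and w_root: "int q dvd w\<^sup>2 + w + 1"
begin

definition k :: nat where "k = (q - 1) div 3"

lemma q_eq: "q = 3 * k + 1"
  using q_mod_3 unfolding k_def by presburger

lemma k_pos: "k > 0"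
  using q_eq q_prime by (cases k) auto

lemma q_gt_1: "q > 1" and int_q_prime: "prime (int q)"
  using q_prime prime_gt_1_nat by auto

lemma not_q_dvd_3: "\<not> int q dvd 3"
proof
  assume "int q dvd 3"
  then have "q dvd 3" by presburger
  then have "q = 3" using q_prime by (simp add: primes_dvd_imp_eq)
  then show False using q_mod_3 by simp
qed

text \<open>Reduction modulo the prime ideal \<open>(q, \<omega> - w)\<close>.\<close>

definition phi :: "eis \<Rightarrow> int" where "phi z = eis_fst z + eis_snd z * w"

lemma phi_simps: "phi 0 = 0" "phi 1 = 1" "phi \<omega> = w" "phi (\<omega>\<^sup>2) = - 1 - w"
  by (simp_all add: phi_def power2_eq_square)

lemma phi_sum: "phi (sum f A) = (\<Sum>a\<in>A. phi (f a))"
  by (induction A rule: infinite_finite_induct) (auto simp: phi_def algebra_simps)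

lemma phi_mult: "[phi (x * y) = phi x * phi y] (mod int q)"
proof -
  have "phi (x * y) - phi x * phi y = - eis_snd x * eis_snd y * (w\<^sup>2 + w + 1)"
    by (simp add: phi_def power2_eq_square algebra_simps)
  then show ?thesis using w_root by (simp add: cong_iff_dvd_diff)
qed

text \<open>The possible differences are, up to sign, w - 1, w + 2 and 2w + 1. Since (w - 1)(w + 2)
  and (2w + 1)^2 are both -3 modulo \<open>q\<close>, a vanishing difference would make
  \<open>q\<close> divide 3.\<close>

lemma cube_roots_eq_if_phi_cong:
  assumes "u \<in> cube_roots" "v \<in> cube_roots" "[phi u = phi v] (mod int q)"
  shows   "u = v"
proof -
  have dvd_3: False if "int q dvd c" "w\<^sup>2 + w + 1 = c * d + 3" for c d
    using that w_root not_q_dvd_3 by (metis dvd_add_right_iff dvd_mult2)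
  have 1: "\<not> int q dvd w - 1" using dvd_3[of "w - 1" "w + 2"]
    by (auto simp: algebra_simps power2_eq_square)
  have 2: "\<not> int q dvd w + 2" using dvd_3[of "w + 2" "w - 1"]
    by (auto simp: algebra_simps power2_eq_square)
  have 3: "\<not> int q dvd 2 * w + 1"
  proof
    assume "int q dvd 2 * w + 1"
    then have "int q dvd 4 * (w\<^sup>2 + w + 1) - (2 * w + 1) * (2 * w + 1)"
      using w_root by (intro dvd_diff dvd_mult) auto
    then show False using not_q_dvd_3 by (simp add: algebra_simps power2_eq_square)
  qed
  have 4: "\<not> int q dvd 1 - w" "\<not> int q dvd - w - 2" "\<not> int q dvd - (2 * w + 1)"
    using 1 2 3 dvd_minus_iff[of "int q" "w - 1"] dvd_minus_iff[of "int q" "w + 2"]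
      dvd_minus_iff[of "int q" "2 * w + 1"] by simp_all
  have "- (2 * w + 1) = - 1 - w * 2" by simp
  with 4(3) have 5: "\<not> int q dvd - 1 - w * 2" by metis
  show ?thesis
    using assms 1 2 3 4 5
    by (auto simp: cube_roots_def phi_simps cong_iff_dvd_diff algebra_simps)
qed

text \<open>The cube root of unity that reduces to n^k modulo the chosen prime ideal. The last
  branch is a default; \<open>chi_phi\<close> shows that it is reached only for n^k congruent to -1
  - w.\<close>

definition chi :: "int \<Rightarrow> eis" where
  "chi n = (if int q dvd n then 0 else if [n ^ k = 1] (mod int q) then 1
     else if [n ^ k = w] (mod int q) then \<omega> else \<omega>\<^sup>2)"

lemma chi_eq_0: "int q dvd n \<Longrightarrow> chi n = 0"
  by (simp add: chi_def)

lemma chi_in: "\<not> int q dvd n \<Longrightarrow> chi n \<in> cube_roots"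
  by (simp add: chi_def cube_roots_def)

lemma chi_phi: "[phi (chi n) = n ^ k] (mod int q)"
proof (cases "int q dvd n")
  case True
  then show ?thesis using k_pos by (simp add: chi_eq_0 phi_simps cong_iff_dvd_diff dvd_trans[OF _ dvd_power])
next
  case False
  have "q = Suc (q - 1)" using q_gt_1 by simp
  then have "n ^ q = n * n ^ (q - 1)" by (metis power_Suc)
  then have "int q dvd n * (n ^ (q - 1) - 1)"
    using int_fermat_dvd[OF q_prime, of n] by (simp add: algebra_simps)
  then have "int q dvd n ^ (q - 1) - 1"
    using False int_q_prime by (simp add: prime_dvd_mult_iff)
  moreover have "q - 1 = k * 3" using q_eq by simp
  then have "n ^ (q - 1) = (n ^ k) ^ 3" by (simp only: power_mult)
  moreover have "(n ^ k) ^ 3 - 1 = (n ^ k - 1) * ((n ^ k - w) * (n ^ k - (- 1 - w)))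
      + (n ^ k - 1) * (w\<^sup>2 + w + 1)"
    by (simp add: power2_eq_square power3_eq_cube algebra_simps)
  ultimately have "int q dvd (n ^ k - 1) * ((n ^ k - w) * (n ^ k - (- 1 - w)))"
    using w_root by (metis dvd_add_left_iff dvd_mult)
  then have "[n ^ k = 1] (mod int q) \<or> [n ^ k = w] (mod int q) \<or> [n ^ k = - 1 - w] (mod int q)"
    using int_q_prime by (auto simp: prime_dvd_mult_iff cong_iff_dvd_diff)
  then show ?thesis
    using False by (auto simp: chi_def phi_simps cong_sym)
qed

lemma chi_eqI:
  assumes "\<not> int q dvd n" "u \<in> cube_roots" "[phi u = n ^ k] (mod int q)"
  shows   "chi n = u"
  using assms by (meson chi_in chi_phi cong_sym cong_trans cube_roots_eq_if_phi_cong)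

lemma chi_mult: "chi (m * n) = chi m * chi n"
proof (cases "int q dvd m * n")
  case True
  then show ?thesis using int_q_prime by (auto simp: prime_dvd_mult_iff chi_eq_0)
next
  case False
  then have mn: "\<not> int q dvd m" "\<not> int q dvd n" by auto
  show ?thesis
  proof (rule chi_eqI[OF False])
    show "chi m * chi n \<in> cube_roots" using mn by (intro cube_roots_mult chi_in)
    have "[phi (chi m * chi n) = phi (chi m) * phi (chi n)] (mod int q)" by (rule phi_mult)
    also have "[phi (chi m) * phi (chi n) = m ^ k * n ^ k] (mod int q)"
      by (intro cong_mult chi_phi)
    finally show "[phi (chi m * chi n) = (m * n) ^ k] (mod int q)"
      by (simp add: power_mult_distrib)
  qed
qed

lemma chi_cong:
  assumes "[m = n] (mod int q)"
  shows   "chi m = chi n"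
proof (cases "int q dvd n")
  case True
  then show ?thesis using assms by (metis chi_eq_0 cong_dvd_iff)
next
  case False
  have "[m ^ k = n ^ k] (mod int q)" using assms by (rule cong_pow)
  with False show ?thesis
    using assms by (metis chi_eqI chi_in chi_phi cong_dvd_iff cong_sym cong_trans)
qed

lemma chi_mod [simp]: "chi (n mod int q) = chi n"
  by (rule chi_cong) simp

lemma chi_1 [simp]: "chi 1 = 1"
  using q_gt_1 by (intro chi_eqI) (auto simp: phi_simps)

lemma chi_minus: "chi (- n) = chi n"
proof -
  have "chi (-1) * chi (-1) = 1" by (simp add: chi_mult [symmetric])
  moreover have "\<not> int q dvd - 1" using q_gt_1 by simp
  ultimately have "chi (-1) = 1"
    using cube_roots_square_eq_1 chi_in by (simp add: power2_eq_square)
  then show ?thesis using chi_mult[of "-1" n] by simp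
qed

lemma chi_mult_cnj: "chi n * eis_cnj (chi n) = (if int q dvd n then 0 else 1)"
  by (simp add: chi_eq_0 cube_roots_mult_cnj chi_in)

lemma chi_square: "(chi n)\<^sup>2 = eis_cnj (chi n)"
  by (cases "int q dvd n") (simp_all add: chi_eq_0 cube_roots_cnj chi_in)

lemma primitive_root_exists:
  "\<exists>g. \<not> int q dvd g \<and> (\<forall>j. int q dvd g ^ j - 1 \<longleftrightarrow> (q - 1) dvd j)"
proof -
  obtain g where g: "residue_primroot q g"
    using prime_primitive_root_exists[of q] q_gt_1 q_prime by auto
  have cop: "coprime q g" and ord: "ord q g = q - 1"
    using g q_prime by (auto simp: residue_primroot_def totient_prime)
  have "\<not> q dvd g" using cop q_gt_1 by (auto dest: coprime_common_divisor)
  then have "\<not> int q dvd int g" by (simp add: int_dvd_int_iff)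
  moreover have "int q dvd int g ^ j - 1 \<longleftrightarrow> (q - 1) dvd j" for j
  proof -
    have "int q dvd int g ^ j - 1 \<longleftrightarrow> [int (g ^ j) = int 1] (mod int q)"
      by (simp add: cong_iff_dvd_diff)
    also have "\<dots> \<longleftrightarrow> [g ^ j = 1] (mod q)" by (rule cong_int_iff)
    also have "\<dots> \<longleftrightarrow> (q - 1) dvd j" by (simp add: ord_divides' ord)
    finally show ?thesis .
  qed
  ultimately show ?thesis by blast
qed

lemma dvd_mult_diffD: "\<not> int q dvd g \<Longrightarrow> int q dvd g * a - g * b \<Longrightarrow> int q dvd a - b"
  using int_q_prime by (metis prime_dvd_mult_iff right_diff_distrib)

lemma sum_chi: "(\<Sum>a\<in>{0..<int q}. chi a) = 0"
proof -
  obtain g where g: "\<not> int q dvd g" "\<And>j. int q dvd g ^ j - 1 \<longleftrightarrow> (q - 1) dvd j"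
    using primitive_root_exists by auto
  have "chi g \<noteq> 1"
  proof
    assume "chi g = 1"
    then have "[1 = g ^ k] (mod int q)" using chi_phi[of g] by (simp add: phi_simps)
    then have "(q - 1) dvd k" using g(2)[of k] by (simp add: cong_iff_dvd_diff dvd_diff_commute)
    then show False using k_pos q_eq by (auto dest: dvd_imp_le)
  qed
  have "(\<Sum>a\<in>{0..<int q}. chi (g * a)) = (\<Sum>a\<in>{0..<int q}. chi a)"
    using q_gt_1 dvd_mult_diffD[OF g(1)] by (intro sum_residues_reindex) auto
  then have "(chi g - 1) * (\<Sum>a\<in>{0..<int q}. chi a) = 0"
    by (simp add: chi_mult sum_distrib_left [symmetric] left_diff_distrib)
  with \<open>chi g \<noteq> 1\<close> show ?thesis by simp
qed

lemma q_dvd_power_sum: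
  assumes "0 < j" "j < q - 1"
  shows   "int q dvd (\<Sum>a\<in>{0..<int q}. a ^ j)"
proof -
  obtain g where g: "\<not> int q dvd g" "\<And>j. int q dvd g ^ j - 1 \<longleftrightarrow> (q - 1) dvd j"
    using primitive_root_exists by auto
  \<comment> \<open>Reindexing needs a \<open>q\<close>-periodic summand, and \<open>a ^ j\<close>
    itself is not periodic, so it is applied to the residues.\<close>
  have "(\<Sum>a\<in>{0..<int q}. (g * a) ^ j mod int q) = (\<Sum>a\<in>{0..<int q}. a ^ j mod int q)"
    using q_gt_1 dvd_mult_diffD[OF g(1)]
    by (intro sum_residues_reindex[where f = "\<lambda>a. a ^ j mod int q"]) (auto simp: power_mod)
  then have "(\<Sum>a\<in>{0..<int q}. (g * a) ^ j) mod int q = (\<Sum>a\<in>{0..<int q}. a ^ j) mod int q"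
    by (metis mod_sum_eq)
  then have "int q dvd (\<Sum>a\<in>{0..<int q}. (g * a) ^ j) - (\<Sum>a\<in>{0..<int q}. a ^ j)"
    by (simp add: mod_eq_dvd_iff)
  also have "(\<Sum>a\<in>{0..<int q}. (g * a) ^ j) - (\<Sum>a\<in>{0..<int q}. a ^ j)
      = (g ^ j - 1) * (\<Sum>a\<in>{0..<int q}. a ^ j)"
    by (simp add: power_mult_distrib sum_distrib_left [symmetric] left_diff_distrib)
  finally show ?thesis
    using g(2)[of j] assms int_q_prime by (auto simp: prime_dvd_mult_iff dest: dvd_imp_le)
qed

definition jacobi_sum :: eis where
  "jacobi_sum = (\<Sum>a\<in>{0..<int q}. chi a * chi (1 - a))"

text \<open>Since \<open>\<chi>(a) \<equiv> a\<^sup>k\<close>, the reduction of the Jacobi sum is a combination of power sums of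
  exponents between \<open>k\<close> and \<open>2k < q - 1\<close>, which vanish modulo \<open>q\<close>.\<close>

lemma phi_jacobi_sum: "int q dvd phi jacobi_sum"
proof -
  let ?A = "{0..<int q}"
  have "[phi jacobi_sum = (\<Sum>a\<in>?A. a ^ k * (1 - a) ^ k)] (mod int q)"
    unfolding jacobi_sum_def phi_sum
  proof (rule cong_sum)
    fix a
    have "[phi (chi a * chi (1 - a)) = phi (chi a) * phi (chi (1 - a))] (mod int q)"
      by (rule phi_mult)
    also have "[phi (chi a) * phi (chi (1 - a)) = a ^ k * (1 - a) ^ k] (mod int q)"
      by (intro cong_mult chi_phi)
    finally show "[phi (chi a * chi (1 - a)) = a ^ k * (1 - a) ^ k] (mod int q)" .
  qed
  moreover have "(\<Sum>a\<in>?A. a ^ k * (1 - a) ^ k) =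
      (\<Sum>i\<le>k. of_nat (k choose i) * (-1) ^ i * (\<Sum>a\<in>?A. a ^ (k + i)))"
  proof -
    have "a ^ k * (1 - a) ^ k = (\<Sum>i\<le>k. of_nat (k choose i) * (-1) ^ i * a ^ (k + i))" for a :: int
    proof -
      have "(1 - a) ^ k = (\<Sum>i\<le>k. of_nat (k choose i) * (- a) ^ i)"
        using binomial_ring[of "- a" 1 k] by simp
      then show ?thesis
        by (simp add: sum_distrib_left power_add mult_ac power_minus[of a])
    qed
    then have "(\<Sum>a\<in>?A. a ^ k * (1 - a) ^ k) =
        (\<Sum>a\<in>?A. \<Sum>i\<le>k. of_nat (k choose i) * (-1) ^ i * a ^ (k + i))" by (simp only:)
    also have "\<dots> = (\<Sum>i\<le>k. \<Sum>a\<in>?A. of_nat (k choose i) * (-1) ^ i * a ^ (k + i))"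
      by (rule sum.swap)
    finally show ?thesis by (simp only: sum_distrib_left)
  qed
  moreover have "int q dvd (\<Sum>i\<le>k. of_nat (k choose i) * (-1) ^ i * (\<Sum>a\<in>?A. a ^ (k + i)))"
    using k_pos q_eq by (intro dvd_sum dvd_mult q_dvd_power_sum) auto
  ultimately show ?thesis by (simp only: cong_dvd_iff)
qed

text \<open>For \<open>c\<close> prime to \<open>q\<close>, substituting \<open>c * a\<close> for
  \<open>a\<close> extracts the square of \<open>chi c\<close>, which is its conjugate. For
  \<open>q\<close> dividing \<open>c\<close> the sum becomes that of the conjugate character and
  vanishes.\<close>

lemma chi_convolution: "(\<Sum>a\<in>{0..<int q}. chi a * chi (c - a)) = jacobi_sum * eis_cnj (chi c)"
proof (cases "int q dvd c")
  case True
  have "chi (c - a) = chi a" for a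
  proof -
    have "chi (c - a) = chi (- a)" using True by (intro chi_cong) (simp add: cong_iff_dvd_diff)
    then show ?thesis by (simp add: chi_minus)
  qed
  then have "(\<Sum>a\<in>{0..<int q}. chi a * chi (c - a)) = eis_cnj (\<Sum>a\<in>{0..<int q}. chi a)"
    by (simp add: power2_eq_square [symmetric] chi_square)
  then show ?thesis using True by (simp add: sum_chi chi_eq_0)
next
  case False
  define F where "F = (\<lambda>a. chi a * chi (c - a))"
  have F: "F (a mod int q) = F a" for a
    unfolding F_def by (metis chi_mod mod_diff_right_eq)
  have "(\<Sum>a\<in>{0..<int q}. F a) = (\<Sum>a\<in>{0..<int q}. F (c * a))"
    using q_gt_1 dvd_mult_diffD[OF False] F by (intro sum_residues_reindex [symmetric]) auto
  also have "\<dots> = (\<Sum>a\<in>{0..<int q}. (chi c)\<^sup>2 * (chi a * chi (1 - a)))"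
  proof (rule sum.cong[OF refl])
    fix a
    have "chi (c - c * a) = chi c * chi (1 - a)"
      by (subst chi_mult [symmetric]) (simp add: algebra_simps)
    then show "F (c * a) = (chi c)\<^sup>2 * (chi a * chi (1 - a))"
      by (simp add: F_def chi_mult power2_eq_square mult_ac)
  qed
  finally show ?thesis
    by (simp add: F_def jacobi_sum_def chi_square sum_distrib_left mult.commute)
qed

text \<open>By scaling, the value is the same at all \<open>c\<close> prime to \<open>q\<close>, and
  the values over all residues add up to 0. The value q - 1 at 0 therefore forces -1
  elsewhere.\<close>

lemma chi_cnj_convolution:
  "(\<Sum>a\<in>{0..<int q}. chi a * eis_cnj (chi (c - a))) = (if int q dvd c then of_int (int q) else 0) - 1"
proof -
  let ?A = "{0..<int q}"
  define D where "D = (\<lambda>c. \<Sum>a\<in>?A. chi a * eis_cnj (chi (c - a)))"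
  have D0: "D c = of_int (int q) - 1" if "int q dvd c" for c
  proof -
    have "chi (c - a) = chi a" for a
    proof -
      have "chi (c - a) = chi (- a)" using that by (intro chi_cong) (simp add: cong_iff_dvd_diff)
      then show ?thesis by (simp add: chi_minus)
    qed
    then have "D c = (\<Sum>a\<in>?A. if int q dvd a then 0 else 1)"
      by (simp add: D_def chi_mult_cnj)
    also have "\<dots> = (\<Sum>a\<in>?A. if a = 0 then 0 else 1)"
      by (intro sum.cong) (auto dest: zdvd_imp_le)
    also have "\<dots> = (\<Sum>a\<in>?A - {0}. 1)"
      using q_gt_1 by (subst sum.remove[of _ 0]) auto
    finally show ?thesis using q_gt_1 by (simp add: card_Diff_singleton)
  qed
  have D1: "D c = D 1" if "\<not> int q dvd c" for c
  proof -
    define F where "F = (\<lambda>a. chi a * eis_cnj (chi (c - a)))"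
    have F: "F (a mod int q) = F a" for a
      unfolding F_def by (metis chi_mod mod_diff_right_eq)
    have "(\<Sum>a\<in>?A. F a) = (\<Sum>a\<in>?A. F (c * a))"
      using q_gt_1 dvd_mult_diffD[OF that] F by (intro sum_residues_reindex [symmetric]) auto
    also have "\<dots> = (\<Sum>a\<in>?A. chi a * eis_cnj (chi (1 - a)))"
    proof (rule sum.cong[OF refl])
      fix a
      have "chi (c - c * a) = chi c * chi (1 - a)"
        by (subst chi_mult [symmetric]) (simp add: algebra_simps)
      then have "F (c * a) = (chi c * eis_cnj (chi c)) * (chi a * eis_cnj (chi (1 - a)))"
        by (simp add: F_def chi_mult mult_ac)
      then show "F (c * a) = chi a * eis_cnj (chi (1 - a))" using that by (simp add: chi_mult_cnj)
    qed
    finally show ?thesis by (simp add: F_def D_def)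
  qed
  have "(\<Sum>c\<in>?A. D c) = (\<Sum>a\<in>?A. chi a * (\<Sum>c\<in>?A. eis_cnj (chi (c - a))))"
    unfolding D_def by (subst sum.swap) (simp add: sum_distrib_left)
  also have "\<dots> = 0"
  proof -
    have "(\<Sum>c\<in>?A. chi (c - a)) = 0" for a
      using sum_residues_reindex[of "int q" chi "\<lambda>c. c - a"] q_gt_1 sum_chi by simp
    then have "(\<Sum>c\<in>?A. eis_cnj (chi (c - a))) = 0" for a
      by (simp only: eis_cnj_sum [symmetric]) simp
    then show ?thesis by simp
  qed
  also have "(\<Sum>c\<in>?A. D c) = D 0 + (\<Sum>c\<in>?A - {0}. D c)"
    using q_gt_1 by (subst sum.remove[of _ 0]) auto
  also have "(\<Sum>c\<in>?A - {0}. D c) = (\<Sum>c\<in>?A - {0}. D 1)"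
    by (intro sum.cong refl D1) (auto dest: zdvd_imp_le)
  also have "\<dots> = (of_int (int q) - 1) * D 1"
    using q_gt_1 by (simp add: card_Diff_singleton of_nat_diff)
  finally have "(of_int (int q) - 1) * (D 1 + 1) = 0"
    by (simp add: D0 algebra_simps)
  moreover have "of_int (int q) - 1 \<noteq> (0 :: eis)" using q_gt_1 by (simp add: eis_eq_iff)
  ultimately have "D 1 = - 1" by (simp add: add_eq_0_iff2)
  then show ?thesis using D0[of c] D1[of c] by (auto simp: D_def)
qed

end

text \<open>The assertion \<open>(z/p)\<^sub>3 = u\<close>, expressed by powers of the quotient of \<open>z\<close> and its conjugate, which
  is \<open>z\<^sup>p\<close> in the inert case. It is vacuous for \<open>p = 3\<close>.\<close>

definition cubic_reciprocal :: "nat \<Rightarrow> eis \<Rightarrow> eis \<Rightarrow> bool" where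
  "cubic_reciprocal p z u \<longleftrightarrow>
     (p mod 3 = 1 \<longrightarrow> of_int (int p) dvd z ^ (p div 3) - u * eis_cnj z ^ (p div 3)) \<and>
     (p mod 3 = 2 \<longrightarrow> of_int (int p) dvd eis_cnj z ^ (p div 3 + 1) - u * z ^ (p div 3 + 1))"

section \<open>Gauss sums in the group ring and reciprocity for Jacobi sums\<close>

context cubic_character
begin

abbreviation gauss :: "eis poly" where "gauss \<equiv> group_sum q chi"
abbreviation gauss_cnj :: "eis poly" where "gauss_cnj \<equiv> group_sum q (\<lambda>a. eis_cnj (chi a))"

lemma q_pos: "q > 0" using q_gt_1 by simp

lemma gauss_square: "gcong q n (gauss * gauss) (smult jacobi_sum gauss_cnj)"
proof -
  have "gcong q n (gauss * gauss) (group_sum q (\<lambda>c. \<Sum>a\<in>{0..<int q}. chi a * chi (c - a)))"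
    by (rule gcong_group_sum_mult) (simp_all add: q_pos)
  then show ?thesis by (simp add: chi_convolution group_sum_smult)
qed

lemma gauss_cnj_square: "gcong q n (gauss_cnj * gauss_cnj) (smult (eis_cnj jacobi_sum) gauss)"
proof -
  have "gcong q n (gauss_cnj * gauss_cnj)
      (group_sum q (\<lambda>c. \<Sum>a\<in>{0..<int q}. eis_cnj (chi a) * eis_cnj (chi (c - a))))"
    by (rule gcong_group_sum_mult[where g = "\<lambda>a. eis_cnj (chi a)"]) (simp_all add: q_pos)
  also have "(\<lambda>c. \<Sum>a\<in>{0..<int q}. eis_cnj (chi a) * eis_cnj (chi (c - a))) =
      (\<lambda>c. eis_cnj jacobi_sum * chi c)"
  proof
    fix c
    have "(\<Sum>a\<in>{0..<int q}. eis_cnj (chi a) * eis_cnj (chi (c - a))) =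
        eis_cnj (\<Sum>a\<in>{0..<int q}. chi a * chi (c - a))" by simp
    then show "(\<Sum>a\<in>{0..<int q}. eis_cnj (chi a) * eis_cnj (chi (c - a))) = eis_cnj jacobi_sum * chi c"
      by (simp only: chi_convolution) simp
  qed
  finally show ?thesis by (simp add: group_sum_smult)
qed

text \<open>This is q minus the sum of all X^a; in a cyclotomic field it would be q.\<close>

abbreviation norm_elem :: "eis poly" where
  "norm_elem \<equiv> group_sum q (\<lambda>c. (if int q dvd c then of_int (int q) else 0) - 1)"

lemma gauss_mult_cnj: "gcong q n (gauss * gauss_cnj) norm_elem"
proof -
  have "gcong q n (gauss * gauss_cnj)
      (group_sum q (\<lambda>c. \<Sum>a\<in>{0..<int q}. chi a * eis_cnj (chi (c - a))))"
    by (rule gcong_group_sum_mult[where g = "\<lambda>a. eis_cnj (chi a)"]) (simp_all add: q_pos)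
  then show ?thesis by (simp only: chi_cnj_convolution)
qed

lemma dvd_diff_residue_iff:
  assumes "a \<in> {0..<int q}"
  shows   "int q dvd c - a \<longleftrightarrow> a = c mod int q"
  using assms q_pos by (auto simp: mod_eq_dvd_iff [symmetric])

text \<open>The Gauss sum annihilates the sum of all X^a because the values of \<open>chi\<close>
  add up to 0, so only the term q survives.\<close>

lemma gauss_mult_norm_elem: "gcong q n (gauss * norm_elem) (smult (of_int (int q)) gauss)"
proof -
  let ?A = "{0..<int q}"
  let ?g = "\<lambda>c. (if int q dvd c then of_int (int q) else 0) - 1 :: eis"
  have "gcong q n (gauss * norm_elem) (group_sum q (\<lambda>c. \<Sum>a\<in>?A. chi a * ?g (c - a)))"
    by (rule gcong_group_sum_mult[where g = ?g]) (simp_all add: q_pos dvd_mod_iff)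
  also have "(\<lambda>c. \<Sum>a\<in>?A. chi a * ?g (c - a)) = (\<lambda>c. of_int (int q) * chi c)"
  proof
    fix c
    have "(\<Sum>a\<in>?A. chi a * ?g (c - a)) =
        (\<Sum>a\<in>?A. (if a = c mod int q then of_int (int q) * chi c else 0) - chi a)"
      by (intro sum.cong) (auto simp: dvd_diff_residue_iff algebra_simps)
    also have "\<dots> = of_int (int q) * chi c"
      using q_pos by (simp add: sum_subtractf sum_chi)
    finally show "(\<Sum>a\<in>?A. chi a * ?g (c - a)) = of_int (int q) * chi c" .
  qed
  finally show ?thesis by (simp add: group_sum_smult)
qed

text \<open>The cube is \<open>jacobi_sum\<close> times \<open>norm_elem\<close>, which is not a
  scalar; one further factor \<open>gauss\<close> turns \<open>norm_elem\<close> into q.\<close>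

lemma gauss_power4: "gcong q n (gauss ^ 4) (smult (jacobi_sum * of_int (int q)) gauss)"
proof -
  have "gauss ^ 4 = gauss * (gauss * (gauss * gauss))" by (simp add: power4_eq_xxxx mult_ac)
  also have "gcong q n \<dots> (gauss * (gauss * smult jacobi_sum gauss_cnj))"
    by (intro gcong_mult_left gauss_square)
  also have "gauss * (gauss * smult jacobi_sum gauss_cnj) = smult jacobi_sum (gauss * (gauss * gauss_cnj))"
    by simp
  also have "gcong q n \<dots> (smult jacobi_sum (gauss * norm_elem))"
    by (intro gcong_smult gcong_mult_left gauss_mult_cnj)
  also have "gcong q n \<dots> (smult jacobi_sum (smult (of_int (int q)) gauss))"
    by (intro gcong_smult gauss_mult_norm_elem)
  finally show ?thesis by simp
qed

lemma gauss_power: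
  "gcong q n (gauss ^ (3 * m + 1)) (smult ((jacobi_sum * of_int (int q)) ^ m) gauss)"
proof (induction m)
  case (Suc m)
  have "gauss ^ (3 * Suc m + 1) = gauss ^ 3 * gauss ^ (3 * m + 1)"
    by (simp only: power_add [symmetric]) (simp add: algebra_simps)
  also have "gcong q n \<dots> (gauss ^ 3 * smult ((jacobi_sum * of_int (int q)) ^ m) gauss)"
    by (intro gcong_mult_left Suc)
  also have "gauss ^ 3 * smult ((jacobi_sum * of_int (int q)) ^ m) gauss =
      smult ((jacobi_sum * of_int (int q)) ^ m) (gauss ^ 4)"
    by (simp add: power3_eq_cube power4_eq_xxxx mult_ac)
  also have "gcong q n \<dots> (smult ((jacobi_sum * of_int (int q)) ^ m)
      (smult (jacobi_sum * of_int (int q)) gauss))"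
    by (intro gcong_smult gauss_power4)
  finally show ?case by (simp add: mult_ac)
qed simp

lemma res_coeff_gauss: "res_coeff q gauss = 1"
  using q_gt_1 by (simp add: res_coeff_group_sum)

lemma res_coeff_norm_elem: "res_coeff q norm_elem = - 1"
  using q_gt_1 by (simp add: res_coeff_group_sum)

text \<open>The square of \<open>gauss * gauss_cnj\<close> is computed in two ways: by squaring each
  factor, and by absorbing \<open>norm_elem\<close> into \<open>gauss\<close>. Both give multiples
  of \<open>norm_elem\<close>, whose coefficient at X is -1.\<close>

lemma jacobi_sum_mult_cnj: "jacobi_sum * eis_cnj jacobi_sum = of_int (int q)"
proof -
  have "gcong q 0 (smult (jacobi_sum * eis_cnj jacobi_sum) norm_elem)
      (smult jacobi_sum (smult (eis_cnj jacobi_sum) (gauss * gauss_cnj)))"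
    by (simp add: gcong_smult gcong_sym gauss_mult_cnj)
  also have "smult jacobi_sum (smult (eis_cnj jacobi_sum) (gauss * gauss_cnj)) =
      smult jacobi_sum gauss_cnj * smult (eis_cnj jacobi_sum) gauss"
    by (simp add: mult_ac)
  also have "gcong q 0 \<dots> ((gauss * gauss) * (gauss_cnj * gauss_cnj))"
    by (intro gcong_mult gcong_sym[OF gauss_square] gcong_sym[OF gauss_cnj_square])
  also have "(gauss * gauss) * (gauss_cnj * gauss_cnj) = gauss_cnj * (gauss * (gauss * gauss_cnj))"
    by (simp add: mult_ac)
  also have "gcong q 0 \<dots> (gauss_cnj * (gauss * norm_elem))"
    by (intro gcong_mult_left gauss_mult_cnj)
  also have "gcong q 0 \<dots> (gauss_cnj * smult (of_int (int q)) gauss)"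
    by (intro gcong_mult_left gauss_mult_norm_elem)
  also have "gauss_cnj * smult (of_int (int q)) gauss = smult (of_int (int q)) (gauss * gauss_cnj)"
    by (simp add: mult_ac)
  also have "gcong q 0 \<dots> (smult (of_int (int q)) norm_elem)"
    by (intro gcong_smult gauss_mult_cnj)
  finally have "of_int 0 dvd res_coeff q (smult (jacobi_sum * eis_cnj jacobi_sum) norm_elem)
      - res_coeff q (smult (of_int (int q)) norm_elem)"
    by (rule gcong_imp_res_coeff)
  then show ?thesis by (simp add: res_coeff_smult res_coeff_norm_elem)
qed

lemma norm_jacobi_sum: "eis_norm jacobi_sum = int q"
  using jacobi_sum_mult_cnj by (simp add: eis_mult_cnj eis_eq_iff)

lemma coprime_prime_q:
  assumes "prime p" "p \<noteq> q"
  shows "coprime (int p) (int q)"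
  using assms q_prime primes_coprime by simp

text \<open>The cube of the Gauss sum is \<open>J (q - \<Sum>X\<^sup>a)\<close> on one side and by Frobenius \<open>\<Sum>\<chi>(a)\<^sup>3 X\<^sup>3\<^sup>a\<close> on
  the other, which fixes \<open>J\<close> modulo 3.\<close>

lemma jacobi_sum_mod_3: "of_int 3 dvd jacobi_sum + 1"
proof -
  define g where "g = (\<lambda>a. if int q dvd a then 0 else 1 :: eis)"
  have "q \<noteq> 3" using q_mod_3 by auto
  then have "coprime (int 3) (int q)" using coprime_prime_q[of 3] by simp
  then have "gcong q (int 3) (gauss ^ 3) (group_sum q g)"
  proof (intro gcong_group_sum_power_prime)
    fix a
    have "int q dvd int 3 * a \<longleftrightarrow> int q dvd a"
      using \<open>coprime (int 3) (int q)\<close> by (metis coprime_commute coprime_dvd_mult_right_iff)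
    then show "g (int 3 * a) = chi a ^ 3"
      by (auto simp: g_def chi_eq_0 cube_roots_cubed chi_in)
  qed (use q_pos in \<open>auto simp: g_def dvd_mod_iff\<close>)
  moreover have "gcong q (int 3) (gauss ^ 3) (smult jacobi_sum norm_elem)"
  proof -
    have "gauss ^ 3 = gauss * (gauss * gauss)" by (simp add: power3_eq_cube mult_ac)
    also have "gcong q (int 3) \<dots> (gauss * smult jacobi_sum gauss_cnj)"
      by (intro gcong_mult_left gauss_square)
    also have "gauss * smult jacobi_sum gauss_cnj = smult jacobi_sum (gauss * gauss_cnj)" by simp
    also have "gcong q (int 3) \<dots> (smult jacobi_sum norm_elem)"
      by (intro gcong_smult gauss_mult_cnj)
    finally show ?thesis .
  qed
  ultimately have "gcong q (int 3) (group_sum q g) (smult jacobi_sum norm_elem)"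
    using gcong_sym gcong_trans by blast
  from gcong_imp_res_coeff[OF this] have "of_int (int 3) dvd g 1 + jacobi_sum"
    using q_gt_1 by (simp add: res_coeff_smult res_coeff_norm_elem res_coeff_group_sum)
  then show ?thesis using q_gt_1 by (simp add: g_def add.commute)
qed

text \<open>\<open>gauss ^ p\<close> is a twist of \<open>gauss\<close> or \<open>gauss_cnj\<close>
  by Frobenius, while \<open>gauss_power\<close> gives a power of \<open>J * Q\<close> as the
  factor. Comparing coefficients at X and using \<open>Q = J * eis_cnj J\<close> relates powers of
  \<open>J\<close> and its conjugate to \<open>chi p\<close>.\<close>

theorem cubic_reciprocal_jacobi_sum:
  assumes p: "prime p" and pq: "p \<noteq> q"
  shows "cubic_reciprocal p jacobi_sum (chi (int p))"
proof -
  define J where "J = jacobi_sum"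
  define Q :: eis where "Q = of_int (int q)"
  define P :: eis where "P = of_int (int p)"
  have cop: "coprime (int p) (int q)" by (rule coprime_prime_q) fact+
  then have cop': "coprime (int p) (eis_norm J)" by (simp add: J_def norm_jacobi_sum)
  have npq: "\<not> int q dvd int p"
    using cop q_gt_1 by (metis coprime_absorb_right coprime_commute int_q_prime not_prime_unit)
  define c where "c = chi (int p)"
  have c: "c \<in> cube_roots" unfolding c_def by (rule chi_in) fact
  then have cc: "c * eis_cnj c = 1" by (rule cube_roots_mult_cnj)
  have JJ: "Q = J * eis_cnj J" by (simp add: J_def Q_def jacobi_sum_mult_cnj)
  have cancel: "P dvd x" if "P dvd J ^ i * x" for i x
    using that
  proof (induction i)
    case (Suc i)
    then have "P dvd J * (J ^ i * x)" by (simp add: mult_ac)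
    then show ?case using Suc.IH cop' of_int_dvd_eis_mult_cancel unfolding P_def by blast
  qed simp
  have case1: "P dvd J ^ m - c * eis_cnj J ^ m" if pm: "p = 3 * m + 1" for m
  proof -
    have mod: "p mod 3 = 1" using pm by simp
    have "gcong q (int p) (gauss ^ p) (group_sum q (\<lambda>a. eis_cnj c * chi a))"
    proof (rule gcong_group_sum_power_prime)
      fix a
      have "chi a ^ p = chi a"
        using mod by (cases "int q dvd a")
          (auto simp: chi_eq_0 chi_in cube_roots_power_mod[of _ p] power_0_left)
      then show "eis_cnj c * chi (int p * a) = chi a ^ p"
        using cc by (simp add: chi_mult c_def mult_ac flip: mult.assoc)
    qed (use p q_pos cop in auto)
    then have "gcong q (int p) (smult ((J * Q) ^ m) gauss) (smult (eis_cnj c) gauss)"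
      using gauss_power[of "int p" m] gcong_sym gcong_trans
      unfolding pm [symmetric] J_def Q_def group_sum_smult by blast
    from gcong_imp_res_coeff[OF this] have "P dvd (J * Q) ^ m - eis_cnj c"
      by (simp add: res_coeff_smult res_coeff_gauss P_def)
    \<comment> \<open>The factor \<open>c\<close> removes \<open>eis_cnj c\<close>, and
      \<open>J ^ m\<close> completes the exponent of \<open>J\<close> to 3m = p - 1, where Frobenius
      gives 1.\<close>
    then have "P dvd c * J ^ m * ((J * Q) ^ m - eis_cnj c)" by (rule dvd_mult)
    also have "c * J ^ m * ((J * Q) ^ m - eis_cnj c) = c * eis_cnj J ^ m * J ^ (3 * m) - (c * eis_cnj c) * J ^ m"
      by (simp add: JJ power_mult_distrib algebra_simps power3_eq_cube power_mult)
    finally have 1: "P dvd c * eis_cnj J ^ m * J ^ (3 * m) - J ^ m" by (simp add: cc)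
    have "P dvd J ^ p - J" unfolding P_def using eis_frobenius(1)[OF p mod] .
    then have "P dvd J ^ 1 * (J ^ (3 * m) - 1)" by (simp add: pm algebra_simps)
    then have "P dvd J ^ (3 * m) - 1" by (rule cancel)
    then have 2: "P dvd c * eis_cnj J ^ m * (J ^ (3 * m) - 1)" by (rule dvd_mult)
    from dvd_diff[OF 2 1] show ?thesis by (simp add: algebra_simps)
  qed
  have case2: "P dvd eis_cnj J ^ m - c * J ^ m" if pm: "p + 1 = 3 * m" for m
  proof -
    have mod: "p mod 3 = 2" using pm by presburger
    have "gcong q (int p) (gauss ^ p) (group_sum q (\<lambda>a. c * eis_cnj (chi a)))"
    proof (rule gcong_group_sum_power_prime)
      fix a
      have "chi a ^ p = eis_cnj (chi a)"
        using mod p by (cases "int q dvd a")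
          (auto simp: chi_eq_0 chi_in cube_roots_power_mod[of _ p] power_0_left cube_roots_cnj)
      then show "c * eis_cnj (chi (int p * a)) = chi a ^ p"
        using cc by (simp add: chi_mult c_def flip: mult.assoc)
    qed (use p q_pos cop in auto)
    then have "gcong q (int p) (gauss ^ p) (smult c gauss_cnj)" by (simp add: group_sum_smult)
    \<comment> \<open>Two more factors raise the exponent p to 3m + 1, so that
      \<open>gauss_power\<close> applies, and turn \<open>gauss_cnj\<close> into a multiple of
      \<open>gauss\<close>.\<close>
    then have "gcong q (int p) (gauss * (gauss * gauss ^ p)) (gauss * (gauss * smult c gauss_cnj))"
      by (intro gcong_mult_left)
    also have "gauss * (gauss * smult c gauss_cnj) = smult c (gauss * (gauss * gauss_cnj))"
      by simp
    also have "gcong q (int p) \<dots> (smult c (gauss * norm_elem))"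
      by (intro gcong_smult gcong_mult_left gauss_mult_cnj)
    also have "gcong q (int p) \<dots> (smult c (smult Q gauss))"
      unfolding Q_def by (intro gcong_smult gauss_mult_norm_elem)
    also have "gauss * (gauss * gauss ^ p) = gauss ^ (3 * m + 1)"
      by (simp flip: pm)
    finally have "gcong q (int p) (smult ((J * Q) ^ m) gauss) (smult c (smult Q gauss))"
      using gauss_power[of "int p" m] gcong_sym gcong_trans unfolding J_def Q_def by blast
    from gcong_imp_res_coeff[OF this] have 1: "P dvd (J * Q) ^ m - c * Q"
      by (simp add: res_coeff_smult res_coeff_gauss P_def)
    have "P dvd J ^ p - eis_cnj J" unfolding P_def using eis_frobenius(2)[OF p mod] .
    \<comment> \<open>Trades the conjugate in \<open>c * Q = c * J * eis_cnj J\<close> for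
      \<open>J ^ p\<close>, so that \<open>J ^ (2 * m)\<close> can be split off.\<close>
    then have "P dvd c * J * (J ^ p - eis_cnj J)" by (rule dvd_mult)
    from dvd_diff[OF 1 this] have "P dvd (J * Q) ^ m - c * J ^ (p + 1)"
      by (simp add: JJ algebra_simps)
    also have "(J * Q) ^ m - c * J ^ (p + 1) = J ^ (2 * m) * (eis_cnj J ^ m - c * J ^ m)"
      unfolding pm JJ by (simp add: power_mult_distrib algebra_simps power_mult power2_eq_square power3_eq_cube)
    finally show ?thesis by (rule cancel)
  qed
  show ?thesis
    unfolding cubic_reciprocal_def
  proof (intro conjI impI)
    assume "p mod 3 = 1"
    then have "p = 3 * (p div 3) + 1" by presburger
    from case1[OF this]
    show "of_int (int p) dvd jacobi_sum ^ (p div 3) - chi (int p) * eis_cnj jacobi_sum ^ (p div 3)"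
      by (simp only: P_def J_def c_def)
  next
    assume "p mod 3 = 2"
    then have "p + 1 = 3 * (p div 3 + 1)" by presburger
    from case2[OF this]
    show "of_int (int p) dvd eis_cnj jacobi_sum ^ (p div 3 + 1) - chi (int p) * jacobi_sum ^ (p div 3 + 1)"
      by (simp only: P_def J_def c_def)
  qed
qed

end

section \<open>Reciprocity for composite moduli\<close>

text \<open>The cubic residue symbol \<open>n \<mapsto> (n/z)\<^sub>3\<close> restricted to rational integers is only characterised, not
  defined: it is periodic modulo the norm of \<open>z\<close>, and reciprocity determines it at primes.\<close>

definition is_cubic_symbol :: "eis \<Rightarrow> (int \<Rightarrow> eis) \<Rightarrow> bool" where
  "is_cubic_symbol z f \<longleftrightarrow>
     (\<forall>m n. f (m * n) = f m * f n) \<and>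
     (\<forall>n. coprime n (eis_norm z) \<longrightarrow> f n \<in> cube_roots) \<and>
     (\<forall>m n. [m = n] (mod eis_norm z) \<longrightarrow> f m = f n) \<and>
     (\<forall>p. prime p \<longrightarrow> coprime (int p) (eis_norm z) \<longrightarrow> cubic_reciprocal p z (f (int p)))"

lemma dvd_power_mult_diff:
  fixes x y :: "'a :: comm_ring_1"
  assumes "d dvd x ^ m - u * x' ^ m" "d dvd y ^ m - v * y' ^ m"
  shows   "d dvd (x * y) ^ m - u * v * (x' * y') ^ m"
proof -
  have "d dvd (x ^ m - u * x' ^ m) * y ^ m + u * x' ^ m * (y ^ m - v * y' ^ m)"
    using assms by (intro dvd_add dvd_mult dvd_mult2)
  then show ?thesis by (simp add: algebra_simps power_mult_distrib)
qed

lemma cubic_reciprocal_mult: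
  "cubic_reciprocal p x u \<Longrightarrow> cubic_reciprocal p y v \<Longrightarrow> cubic_reciprocal p (x * y) (u * v)"
  unfolding cubic_reciprocal_def eis_cnj_simps by (meson dvd_power_mult_diff)

lemma cubic_reciprocal_of_int: "cubic_reciprocal p (of_int n) 1"
  by (simp add: cubic_reciprocal_def)

text \<open>A rational integer is its own conjugate, so the quotient defining the symbol is
  1.\<close>

lemma is_cubic_symbol_of_int: "is_cubic_symbol (of_int n) (\<lambda>_. 1)"
  by (simp add: is_cubic_symbol_def cubic_reciprocal_of_int)

lemma is_cubic_symbol_mult:
  assumes "is_cubic_symbol x f" "is_cubic_symbol y g"
  shows   "is_cubic_symbol (x * y) (\<lambda>n. f n * g n)"
proof -
  have "f m = f n" "g m = g n" if "[m = n] (mod eis_norm x * eis_norm y)" for m n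
    using assms cong_modulus_mult[OF that] cong_modulus_mult[of m n "eis_norm y" "eis_norm x"] that
    unfolding is_cubic_symbol_def by (auto simp: mult.commute)
  with assms show ?thesis
    unfolding is_cubic_symbol_def eis_norm_mult
    by (auto simp: coprime_mult_right_iff mult_ac intro!: cube_roots_mult cubic_reciprocal_mult)
qed

lemma (in cubic_character) is_cubic_symbol_jacobi_sum: "is_cubic_symbol jacobi_sum chi"
  unfolding is_cubic_symbol_def norm_jacobi_sum
proof (intro conjI allI impI)
  fix n assume "coprime n (int q)"
  then show "chi n \<in> cube_roots"
    using q_gt_1 by (intro chi_in) (auto dest: coprime_common_divisor)
next
  fix p assume "prime p" "coprime (int p) (int q)"
  moreover from this have "p \<noteq> q" using q_gt_1 by auto
  ultimately show "cubic_reciprocal p jacobi_sum (chi (int p))"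
    by (intro cubic_reciprocal_jacobi_sum)
qed (auto simp: chi_mult intro: chi_cong)

text \<open>The Jacobi sum generates the prime ideal chosen by \<open>w\<close>: both
  \<open>z\<close> and \<open>jacobi_sum\<close> lie in it, so \<open>z * eis_cnj jacobi_sum\<close>
  is divisible by q, which is the norm of \<open>jacobi_sum\<close>.\<close>

lemma (in cubic_character) jacobi_sum_dvd:
  assumes "int q dvd phi z"
  shows   "jacobi_sum dvd z"
proof -
  define a b c d where abcd: "a = eis_fst z" "b = eis_snd z" "c = eis_fst jacobi_sum" "d = eis_snd jacobi_sum"
  have 1: "int q dvd a + b * w" and 2: "int q dvd c + d * w"
    using assms phi_jacobi_sum by (simp_all add: phi_def abcd)
  have "int q dvd b * (c + d * w) - d * (a + b * w)" using 1 2 by (intro dvd_diff dvd_mult)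
  then have 3: "int q dvd b * c - a * d" by (simp add: algebra_simps)
  have "a * c + b * d - a * d = (a + b * w) * c - b * w * (c + d * w) + b * d * (w\<^sup>2 + w + 1)
      + (b * c - a * d) - b * (c + d * w)"
    by (simp add: algebra_simps power2_eq_square)
  also have "int q dvd \<dots>"
    by (rule dvd_diff[OF dvd_add[OF dvd_add[OF dvd_diff[OF dvd_mult2[OF 1] dvd_mult[OF 2]]
      dvd_mult[OF w_root]] 3] dvd_mult[OF 2]])
  finally have 4: "int q dvd a * c + b * d - a * d" .
  have "of_int (int q) dvd z * eis_cnj jacobi_sum"
    unfolding of_int_dvd_eis_iff using 3 4 by (simp add: abcd algebra_simps)
  then obtain y where "z * eis_cnj jacobi_sum = of_int (int q) * y" by (elim dvdE)
  then have "eis_cnj jacobi_sum * z = eis_cnj jacobi_sum * (jacobi_sum * y)"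
    by (simp only: jacobi_sum_mult_cnj [symmetric] mult_ac)
  moreover have "eis_cnj jacobi_sum \<noteq> 0"
    using norm_jacobi_sum q_gt_1 by (metis eis_norm_cnj eis_norm_eq_0_iff less_nat_zero_code of_nat_eq_0_iff)
  ultimately show ?thesis by simp
qed

text \<open>If q were 2 modulo 3, Fermat together with w^3 = 1 would give w = w^q = w^2, so w would
  be 0 or 1; then q divides 1 or 3.\<close>

lemma prime_mod_3_if_root:
  assumes "prime q" "q \<noteq> 3" "int q dvd w\<^sup>2 + w + 1"
  shows   "q mod 3 = 1"
proof (rule ccontr)
  assume "q mod 3 \<noteq> 1"
  moreover have "q mod 3 \<noteq> 0"
    using assms(1,2) by (auto simp: prime_nat_iff dvd_eq_mod_eq_0 [symmetric])
  ultimately have "q mod 3 = 2" by linarith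
  then have q: "q = 3 * (q div 3) + 2" by presburger
  have pq: "prime (int q)" using assms(1) by simp
  have "w ^ 3 - 1 = (w - 1) * (w\<^sup>2 + w + 1)"
    by (simp add: power2_eq_square power3_eq_cube algebra_simps)
  then have "[w ^ 3 = 1] (mod int q)" using assms(3) by (simp add: cong_iff_dvd_diff)
  then have "[(w ^ 3) ^ (q div 3) * w\<^sup>2 = 1 ^ (q div 3) * w\<^sup>2] (mod int q)"
    by (intro cong_mult cong_pow cong_refl)
  moreover have "(w ^ 3) ^ (q div 3) * w\<^sup>2 = w ^ q"
    by (metis power_add power_mult q)
  ultimately have "int q dvd w ^ q - w\<^sup>2" by (simp add: cong_iff_dvd_diff)
  from dvd_diff[OF int_fermat_dvd[OF assms(1), of w] this]
  have "int q dvd w * (w - 1)" by (simp add: algebra_simps power2_eq_square)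
  then have "int q dvd w \<or> int q dvd w - 1" using pq by (simp add: prime_dvd_mult_iff)
  then have "int q dvd 3"
  proof
    assume "int q dvd w"
    then have "int q dvd (w\<^sup>2 + w + 1) - w * (w + 1)" using assms(3) by (intro dvd_diff) auto
    then have "int q dvd 1" by (simp add: algebra_simps power2_eq_square)
    then show ?thesis using pq by auto
  next
    assume "int q dvd w - 1"
    then have "int q dvd (w\<^sup>2 + w + 1) - (w - 1) * (w + 2)" using assms(3) by (intro dvd_diff) auto
    then show ?thesis by (simp add: algebra_simps power2_eq_square)
  qed
  then have "int q dvd int 3" by simp
  then have "q dvd 3" by (simp only: int_dvd_int_iff)
  then show False using assms(1,2) by (simp add: primes_dvd_imp_eq)
qed

text \<open>Induction on the norm. A prime \<open>q\<close> dividing the norm either divides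
  \<open>z\<close>, or a Jacobi sum of norm \<open>q\<close> does. Both factors have second
  coordinate divisible by 3, so the cofactor again satisfies the hypotheses; at norm 1 only 1 and -1
  are left.\<close>

theorem cubic_symbol_exists:
  assumes "3 dvd eis_snd z" "\<not> 3 dvd eis_fst z"
  shows   "\<exists>f. is_cubic_symbol z f"
  using assms
proof (induction "nat (eis_norm z)" arbitrary: z rule: less_induct)
  case less
  define a b where ab: "a = eis_fst z" "b = eis_snd z"
  have norm: "eis_norm z = a\<^sup>2 - a * b + b\<^sup>2" by (simp add: ab eis_norm_def)
  have "z \<noteq> 0" using less.prems by auto
  then have norm_pos: "eis_norm z > 0" using eis_norm_nonneg[of z] eis_norm_eq_0_iff[of z] by linarith
  have not3: "\<not> 3 dvd eis_norm z"
  proof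
    assume "3 dvd eis_norm z"
    then have "3 dvd (a\<^sup>2 - a * b + b\<^sup>2) + b * (a - b)"
      using less.prems by (auto simp: norm ab)
    then have "3 dvd a\<^sup>2" by (simp add: algebra_simps power2_eq_square)
    then have "3 dvd a" using prime_dvd_power[of "3 :: int" a 2] by simp
    then show False using less.prems by (simp add: ab)
  qed
  have step: "\<exists>f. is_cubic_symbol z f"
    if zxy: "z = x * y" and f: "is_cubic_symbol x f" and x: "eis_norm x > 1" "3 dvd eis_snd x" for x y f
  proof -
    have norm': "eis_norm z = eis_norm x * eis_norm y" by (simp add: zxy eis_norm_mult)
    then have "eis_norm y > 0" using norm_pos x(1) by (simp add: zero_less_mult_iff)
    then have "eis_norm y < eis_norm z" using x(1) by (simp add: norm')
    then have "nat (eis_norm y) < nat (eis_norm z)" using norm_pos by simp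
    moreover have "3 dvd eis_snd y" "\<not> 3 dvd eis_fst y"
    proof -
      have p3: "prime (3 :: int)" by simp
      have "\<not> 3 dvd eis_fst x * eis_fst y - eis_snd x * eis_snd y"
        using less.prems(2) by (simp add: zxy)
      then have *: "\<not> 3 dvd eis_fst x * eis_fst y"
        using x(2) by (metis dvd_diff dvd_mult2)
      then show "\<not> 3 dvd eis_fst y" by auto
      have "3 dvd eis_fst x * eis_snd y + eis_snd x * eis_fst y - eis_snd x * eis_snd y"
        using less.prems(1) by (simp add: zxy)
      from dvd_diff[OF this dvd_mult2[OF x(2), of "eis_fst y - eis_snd y"]]
      have "3 dvd eis_fst x * eis_snd y" by (simp add: algebra_simps)
      then show "3 dvd eis_snd y" using * p3 by (auto simp: prime_dvd_mult_iff)
    qed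
    ultimately obtain g where "is_cubic_symbol y g" using less.hyps by blast
    then show ?thesis using f is_cubic_symbol_mult zxy by blast
  qed
  show ?case
  proof (cases "eis_norm z = 1")
    case True
    have "4 * eis_norm z = (2 * a - b)\<^sup>2 + 3 * b\<^sup>2"
      by (simp add: norm algebra_simps power2_eq_square)
    then have "3 * b\<^sup>2 \<le> 4" using True zero_le_power2[of "2 * a - b"] by linarith
    moreover obtain b' where "b = 3 * b'" using less.prems(1) by (auto simp: ab)
    ultimately have "27 * b'\<^sup>2 \<le> 4" "b = 3 * b'" by (simp_all add: power_mult_distrib)
    then have "b = 0" using zero_less_power2[of b'] by linarith
    then have "z = of_int a" by (simp add: ab eis_eq_iff)
    then show ?thesis using is_cubic_symbol_of_int by blast
  next
    case False
    then have "nat (eis_norm z) \<noteq> 1" using norm_pos by linarith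
    then obtain q where q: "prime q" "q dvd nat (eis_norm z)" using prime_factor_nat by blast
    have qn: "int q dvd eis_norm z" using q(2) norm_pos by (simp add: int_dvd_int_iff [symmetric])
    have "q \<noteq> 3" using qn not3 by auto
    have pq: "prime (int q)" "int q > 1" using q(1) prime_gt_1_nat by auto
    show ?thesis
    proof (cases "int q dvd b")
      case True
      then have "int q dvd (a\<^sup>2 - a * b + b\<^sup>2) + b * (a - b)"
        using dvd_add[OF qn dvd_mult2, of b "a - b"] unfolding norm by blast
      then have "int q dvd a\<^sup>2" by (simp add: algebra_simps power2_eq_square)
      then have "int q dvd a" using pq prime_dvd_power by blast
      with True have "of_int (int q) dvd z" unfolding of_int_dvd_eis_iff by (simp add: ab)
      then obtain y where "z = of_int (int q) * y" by (elim dvdE)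
      then show ?thesis
        using is_cubic_symbol_of_int by (rule step) (use pq(2) in \<open>auto intro: one_less_power\<close>)
    next
      case False
      then have "coprime b (int q)" using pq(1) prime_imp_coprime coprime_commute by blast
      then obtain b' where b': "[b * b' = 1] (mod int q)" using cong_solve_coprime_int by blast
      \<comment> \<open>The root of a + b w modulo \<open>q\<close>, so that \<open>phi z\<close>
        vanishes. The norm of \<open>z\<close> is then b^2 (w^2 + w + 1) modulo \<open>q\<close>,
        which makes \<open>w\<close> a cube root of unity.\<close>
      define w where "w = - a * b'"
      have "int q dvd b * b' - 1" using b' by (simp add: cong_iff_dvd_diff)
      then have "int q dvd a * (1 - b * b')" by (metis dvd_diff_commute dvd_mult)
      then have phi: "int q dvd a + b * w" by (simp add: w_def algebra_simps)
      have "int q dvd (a\<^sup>2 - a * b + b\<^sup>2) - (a + b * w) * (a - b * w - b)"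
        using qn phi by (intro dvd_diff) (auto simp: norm)
      also have "(a\<^sup>2 - a * b + b\<^sup>2) - (a + b * w) * (a - b * w - b) = b\<^sup>2 * (w\<^sup>2 + w + 1)"
        by (simp add: algebra_simps power2_eq_square)
      finally have w: "int q dvd w\<^sup>2 + w + 1"
        using False pq prime_dvd_power[of "int q" b 2] by (auto simp: prime_dvd_mult_iff)
      interpret cubic_character q w
        by unfold_locales (use q(1) \<open>q \<noteq> 3\<close> w prime_mod_3_if_root in auto)
      have "jacobi_sum dvd z" using phi by (intro jacobi_sum_dvd) (simp add: phi_def ab)
      then obtain y where "z = jacobi_sum * y" by (elim dvdE)
      then show ?thesis
        using is_cubic_symbol_jacobi_sum
        by (rule step) (use pq jacobi_sum_mod_3[unfolded of_int_dvd_eis_iff] in \<open>auto simp: norm_jacobi_sum\<close>)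
    qed
  qed
qed

text \<open>The symbol \<open>(\<omega>/n)\<^sub>3\<close>.\<close>

definition omega_char :: "int \<Rightarrow> eis" where
  "omega_char n = \<omega> ^ nat ((n\<^sup>2 - 1) div 3)"

lemma square_mod_3:
  fixes n :: int
  assumes "\<not> 3 dvd n"
  obtains i where "n\<^sup>2 = 3 * int i + 1"
proof -
  have "n mod 3 = 1 \<or> n mod 3 = 2" using assms by presburger
  then have "(n mod 3)\<^sup>2 mod 3 = 1" by (elim disjE) (simp_all del: power_mod)
  then have "n\<^sup>2 mod 3 = 1" by (simp only: power_mod)
  then have *: "n\<^sup>2 = 3 * (n\<^sup>2 div 3) + 1" by presburger
  have "n\<^sup>2 div 3 \<ge> 0" by (simp add: pos_imp_zdiv_nonneg_iff)
  with * show ?thesis by (intro that[of "nat (n\<^sup>2 div 3)"]) simp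
qed

lemma omega_char_eq: "n\<^sup>2 = 3 * int i + 1 \<Longrightarrow> omega_char n = \<omega> ^ i"
  by (simp add: omega_char_def)

lemma omega_char_mult:
  assumes "\<not> 3 dvd m" "\<not> 3 dvd n"
  shows   "omega_char (m * n) = omega_char m * omega_char n"
proof -
  obtain i j where ij: "m\<^sup>2 = 3 * int i + 1" "n\<^sup>2 = 3 * int j + 1"
    using assms square_mod_3 by metis
  then have "(m * n)\<^sup>2 = 3 * int (i + j + 3 * (i * j)) + 1"
    by (simp add: power_mult_distrib algebra_simps)
  then have "omega_char (m * n) = \<omega> ^ (i + j + 3 * (i * j))" by (rule omega_char_eq)
  also have "\<dots> = \<omega> ^ (i + j)" by (rule eis_omega_power_cong) simp
  finally show ?thesis using ij by (simp add: omega_char_eq power_add)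
qed

lemma omega_char_cong:
  assumes "9 dvd m - n" "\<not> 3 dvd n"
  shows   "omega_char m = omega_char n"
proof -
  obtain c where c: "m - n = 9 * c" using assms(1) by (elim dvdE)
  then have m: "m = n + 9 * c" by simp
  have "\<not> 3 dvd m"
  proof
    assume "3 dvd m"
    then have "3 dvd m - 3 * (3 * c)" by simp
    then show False using assms(2) m by simp
  qed
  then obtain i j where ij: "m\<^sup>2 = 3 * int i + 1" "n\<^sup>2 = 3 * int j + 1"
    using assms(2) square_mod_3 by metis
  then have "3 * int i = 3 * int j + 3 * (3 * (2 * n * c + 9 * c\<^sup>2))"
    unfolding m by (simp add: power2_eq_square algebra_simps)
  then have "int i = int j + 3 * (2 * n * c + 9 * c\<^sup>2)" by linarith
  then have "int i mod 3 = int j mod 3" by (simp only: mod_mult_self2)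
  then have "int (i mod 3) = int (j mod 3)" by (simp add: of_nat_mod)
  then have "i mod 3 = j mod 3" by (simp only: of_nat_eq_iff)
  then have "\<omega> ^ i = \<omega> ^ j" by (rule eis_omega_power_cong)
  then show ?thesis using ij by (simp add: omega_char_eq)
qed

section \<open>Values of a cubic symbol at rational integers\<close>

locale cubic_symbol =
  fixes z :: eis and f :: "int \<Rightarrow> eis"
  assumes symbol: "is_cubic_symbol z f"
begin

lemma symbol_mult: "f (m * n) = f m * f n"
  and symbol_in: "coprime n (eis_norm z) \<Longrightarrow> f n \<in> cube_roots"
  and symbol_cong: "[m = n] (mod eis_norm z) \<Longrightarrow> f m = f n"
  and symbol_reciprocal:
    "prime p \<Longrightarrow> coprime (int p) (eis_norm z) \<Longrightarrow> cubic_reciprocal p z (f (int p))"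
  using symbol unfolding is_cubic_symbol_def by blast+

lemma symbol_1: "f 1 = 1"
proof -
  have "f 1 * f 1 = f 1" by (simp flip: symbol_mult)
  moreover have "f 1 \<in> cube_roots" by (rule symbol_in) simp
  ultimately show ?thesis by (auto simp: cube_roots_def eis_eq_iff power2_eq_square)
qed

lemma symbol_power: "f (n ^ k) = f n ^ k"
  by (induction k) (simp_all add: symbol_1 symbol_mult)

lemma symbol_minus_1: "f (- 1) = 1"
proof -
  have "(f (- 1))\<^sup>2 = 1" by (simp add: symbol_1 flip: symbol_power)
  moreover have "f (- 1) \<in> cube_roots" by (rule symbol_in) simp
  ultimately show ?thesis by (simp add: cube_roots_square_eq_1)
qed

lemma symbol_cancel:
  assumes "of_int n dvd z ^ i * x" "coprime n (eis_norm z)"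
  shows   "of_int n dvd x"
  using assms(1)
proof (induction i)
  case (Suc i)
  then have "of_int n dvd z * (z ^ i * x)" by (simp add: mult_ac)
  then show ?case using Suc.IH assms(2) of_int_dvd_eis_mult_cancel by blast
qed simp

text \<open>Modulo \<open>l\<close> the quotient of the conjugate by \<open>z\<close> is minus a
  power of omega, so its power in \<open>cubic_reciprocal\<close> is explicit. Comparing with
  \<open>(l^2 - 1) / 3\<close>, which modulo 3 is 2m for l = 3m + 1 and m for l = 3m - 1, identifies
  it with \<open>omega_char\<close>.\<close>

lemma symbol_at_prime:
  assumes l: "prime l" and cop: "coprime (int l) (eis_norm z)" "l \<noteq> 3"
    and dvd: "of_int (int l) dvd eis_cnj z + \<omega> ^ j * z"
  shows "f (int l) = omega_char (int l) ^ j"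
proof -
  define L :: eis where "L = of_int (int l)"
  define u where "u = f (int l)"
  have u: "u \<in> cube_roots" unfolding u_def by (rule symbol_in) fact
  have R: "cubic_reciprocal l z u" unfolding u_def by (rule symbol_reciprocal) fact+
  have l1: "int l > 1" using l prime_gt_1_nat by auto
  have L1: "\<bar>int l\<bar> > 1" using l1 by simp
  \<comment> \<open>The sign in the quotient disappears: for odd \<open>l\<close> the exponent is
    even, and modulo 2 signs do not matter.\<close>
  have pow: "L dvd eis_cnj z ^ m - \<omega> ^ (j * m) * z ^ m" if "even m \<or> l = 2" for m
  proof -
    have "eis_cnj z - (- (\<omega> ^ j * z)) dvd eis_cnj z ^ m - (- (\<omega> ^ j * z)) ^ m"
      by (simp add: power_diff_sumr2)
    moreover have "L dvd eis_cnj z - (- (\<omega> ^ j * z))" using dvd by (simp add: L_def)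
    ultimately have 1: "L dvd eis_cnj z ^ m - (- (\<omega> ^ j * z)) ^ m" using dvd_trans by blast
    have "L dvd (- (\<omega> ^ j * z)) ^ m - \<omega> ^ (j * m) * z ^ m"
    proof (cases "even m")
      case True
      then show ?thesis by (simp add: power_mult_distrib power_mult)
    next
      case False
      then have *: "(- (\<omega> ^ j * z)) ^ m - \<omega> ^ (j * m) * z ^ m = 2 * - (\<omega> ^ (j * m) * z ^ m)"
        by (simp add: power_mult_distrib power_mult)
      have "L = 2" using False that by (simp add: L_def)
      then show ?thesis unfolding * by (simp only: dvd_triv_left)
    qed
    from dvd_add[OF 1 this] show ?thesis by simp
  qed
  have parity: "even l \<Longrightarrow> l = 2"
    using l prime_odd_nat[of l] prime_ge_2_nat[of l] by (cases "l = 2") auto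
  have "l mod 3 \<noteq> 0"
    using l cop(2) by (auto simp: prime_nat_iff dvd_eq_mod_eq_0 [symmetric])
  then consider "l mod 3 = 1" | "l mod 3 = 2" by linarith
  then show ?thesis
  proof cases
    case 1
    define m where "m = l div 3"
    have lm: "l = 3 * m + 1" using 1 unfolding m_def by presburger
    have "L dvd z ^ m - u * eis_cnj z ^ m" using R 1 by (simp add: cubic_reciprocal_def m_def L_def)
    moreover have "L dvd u * (eis_cnj z ^ m - \<omega> ^ (j * m) * z ^ m)"
      using parity lm by (intro dvd_mult pow) (cases "even m"; simp)
    ultimately have "L dvd (z ^ m - u * eis_cnj z ^ m) + u * (eis_cnj z ^ m - \<omega> ^ (j * m) * z ^ m)"
      by (rule dvd_add)
    then have "L dvd z ^ m * (1 - u * \<omega> ^ (j * m))" by (simp add: algebra_simps)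
    then have "of_int (int l) dvd 1 - u * \<omega> ^ (j * m)"
      unfolding L_def using cop(1) by (rule symbol_cancel)
    then have *: "1 = u * \<omega> ^ (j * m)"
      using u L1 by (intro cube_roots_eqI[of _ _ "int l"] cube_roots_mult) auto
    have "u = u * \<omega> ^ (3 * (j * m))" by (simp only: power_mult eis_omega_cubed) simp
    also have "3 * (j * m) = j * m + 2 * (j * m)" by simp
    also have "u * \<omega> ^ (j * m + 2 * (j * m)) = (u * \<omega> ^ (j * m)) * \<omega> ^ (2 * (j * m))"
      by (simp only: power_add mult.assoc)
    also have "\<dots> = \<omega> ^ (2 * (j * m))" by (simp only: * [symmetric]) simp
    finally have uu: "u = \<omega> ^ (2 * (j * m))" .
    have "(int l)\<^sup>2 = 3 * int (3 * m * m + 2 * m) + 1"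
      by (simp add: lm power2_eq_square algebra_simps)
    then have "omega_char (int l) = \<omega> ^ (3 * m * m + 2 * m)" by (rule omega_char_eq)
    also have "\<dots> = \<omega> ^ (2 * m)" by (rule eis_omega_power_cong) (simp add: mult.assoc)
    finally show ?thesis using uu by (simp add: u_def mult_ac flip: power_mult)
  next
    case 2
    define m where "m = l div 3 + 1"
    have lm: "l + 1 = 3 * m" using 2 unfolding m_def by presburger
    have "L dvd eis_cnj z ^ m - u * z ^ m" using R 2 by (simp add: cubic_reciprocal_def m_def L_def)
    moreover have "L dvd eis_cnj z ^ m - \<omega> ^ (j * m) * z ^ m"
    proof (rule pow)
      show "even m \<or> l = 2" using parity lm by presburger
    qed
    ultimately have "L dvd (eis_cnj z ^ m - u * z ^ m) - (eis_cnj z ^ m - \<omega> ^ (j * m) * z ^ m)"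
      by (rule dvd_diff)
    then have "L dvd z ^ m * (\<omega> ^ (j * m) - u)" by (simp add: algebra_simps)
    then have "of_int (int l) dvd \<omega> ^ (j * m) - u"
      unfolding L_def using cop(1) by (rule symbol_cancel)
    then have uu: "\<omega> ^ (j * m) = u"
      using u L1 by (intro cube_roots_eqI[of _ _ "int l"]) auto
    obtain m' where m': "m = Suc m'" by (simp add: m_def)
    have "int l = 3 * int m' + 2" using lm m' by simp
    then have "(int l)\<^sup>2 = 3 * int (3 * (m' * m' + m') + m) + 1"
      by (simp add: m' power2_eq_square algebra_simps)
    then have "omega_char (int l) = \<omega> ^ (3 * (m' * m' + m') + m)" by (rule omega_char_eq)
    also have "\<dots> = \<omega> ^ m" by (rule eis_omega_power_cong) (simp only: mod_mult_self4)
    finally show ?thesis using uu by (simp add: u_def mult.commute flip: power_mult)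
  qed
qed

lemma symbol_at_int:
  assumes "coprime n (eis_norm z)" "\<not> 3 dvd n" "of_int n dvd eis_cnj z + \<omega> ^ j * z"
  shows "f n = omega_char n ^ j"
  using assms
proof (induction n rule: prime_divisors_induct)
  case (unit n)
  then have "n = 1 \<or> n = - 1" by auto
  then show ?case by (auto simp: symbol_1 symbol_minus_1 omega_char_def)
next
  case (factor p n)
  obtain l where "p = int l" using prime_ge_0_int[OF factor(1)] nonneg_int_cases by blast
  with factor(1) have l: "p = int l" "prime l" by auto
  have cop: "coprime p (eis_norm z)" "coprime n (eis_norm z)"
    using factor.prems(1) by (simp_all add: coprime_mult_left_iff)
  have n3: "\<not> 3 dvd p" "\<not> 3 dvd n" using factor.prems(2) by (blast intro: dvd_mult dvd_mult2)+
  have "of_int p * of_int n dvd eis_cnj z + \<omega> ^ j * z" using factor.prems(3) by simp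
  then have dvd: "of_int p dvd eis_cnj z + \<omega> ^ j * z" "of_int n dvd eis_cnj z + \<omega> ^ j * z"
    by (rule dvd_mult_left, rule dvd_mult_right)
  have "f n = omega_char n ^ j" using cop(2) n3(2) dvd(2) by (rule factor.IH)
  moreover have "l \<noteq> 3" using n3(1) l(1) by auto
  then have "f (int l) = omega_char (int l) ^ j"
    using l cop(1) dvd(1) by (intro symbol_at_prime) simp_all
  moreover have "omega_char (p * n) = omega_char p * omega_char n"
    using n3 by (rule omega_char_mult)
  ultimately show ?case by (simp add: symbol_mult l power_mult_distrib)
qed simp

text \<open>For \<open>z = a + b \<omega>\<close> one has \<open>(a - 2b)(a + b) \<equiv> -3b\<^sup>2\<close> modulo the norm, and modulo the factors on
  the left \<open>z\<close> is a rational multiple of \<open>2 + \<omega>\<close> and \<open>\<omega> - 1\<close>, so their symbols are known.\<close>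

lemma symbol_3_square:
  assumes b: "9 dvd eis_snd z" and a: "\<not> 3 dvd eis_fst z" and cop: "coprime (3 * (eis_snd z)\<^sup>2) (eis_norm z)"
  shows "f (3 * (eis_snd z)\<^sup>2) = 1"
proof -
  define a b where ab: "a = eis_fst z" "b = eis_snd z"
  have norm: "eis_norm z = a\<^sup>2 - a * b + b\<^sup>2" by (simp add: ab eis_norm_def)
  have "(a - 2 * b) * (a + b) - (- 1 * (3 * b\<^sup>2)) = eis_norm z"
    by (simp add: norm power2_eq_square algebra_simps)
  then have cong: "[(a - 2 * b) * (a + b) = - 1 * (3 * b\<^sup>2)] (mod eis_norm z)"
    by (simp add: cong_iff_dvd_diff)
  have "coprime (- 1 * (3 * b\<^sup>2)) (eis_norm z)" using cop by (simp add: ab)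
  with cong have cop': "coprime ((a - 2 * b) * (a + b)) (eis_norm z)"
    by (metis cong_imp_coprime cong_sym)
  obtain c where c: "b = 9 * c" using b by (auto simp: ab)
  have n3: "\<not> 3 dvd a - 2 * b" "\<not> 3 dvd a + b" "\<not> 3 dvd a"
    using a unfolding c ab(1) [symmetric] by presburger+
  have "f (a - 2 * b) = omega_char (a - 2 * b) ^ 1"
  proof (rule symbol_at_int)
    show "of_int (a - 2 * b) dvd eis_cnj z + \<omega> ^ 1 * z"
      unfolding of_int_dvd_eis_iff by (simp add: ab algebra_simps)
  qed (use cop' n3 in auto)
  \<comment> \<open>Here 9 must divide b, which is why \<open>z\<close> carries the coefficient
    9.\<close>
  also have "omega_char (a - 2 * b) = omega_char a" by (rule omega_char_cong) (use n3 c in auto)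
  finally have 1: "f (a - 2 * b) = omega_char a" by simp
  have "f (a + b) = omega_char (a + b) ^ 2"
  proof (rule symbol_at_int)
    have "eis_cnj z + \<omega> ^ 2 * z = of_int (a + b) * (- \<omega>)"
      by (simp add: eis_eq_iff ab power2_eq_square algebra_simps)
    then show "of_int (a + b) dvd eis_cnj z + \<omega> ^ 2 * z" by (metis dvd_triv_left)
  qed (use cop' n3 in auto)
  also have "omega_char (a + b) = omega_char a" by (rule omega_char_cong) (use n3 c in auto)
  finally have 2: "f (a + b) = omega_char a ^ 2" .
  have "f (3 * b\<^sup>2) = f (- 1 * (3 * b\<^sup>2))" unfolding symbol_mult[of "- 1"] symbol_minus_1 by simp
  also have "\<dots> = f ((a - 2 * b) * (a + b))" using symbol_cong[OF cong] by simp
  \<comment> \<open>The exponents 1 and 2 of the two factors add up to 3.\<close>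
  also have "\<dots> = omega_char a ^ 3" by (simp only: symbol_mult 1 2) (simp add: power2_eq_square power3_eq_cube)
  also have "\<dots> = 1" unfolding omega_char_def by (rule cube_roots_cubed) simp
  finally show ?thesis by (simp add: ab)
qed

end

section \<open>The binomial sum as a Lucas-type sequence\<close>

text \<open>The Morgan-Voyce polynomial b_n at 27; its recurrence has the coefficient 27 + 2 =
  29.\<close>

definition binom_sum :: "nat \<Rightarrow> int" where
  "binom_sum n = (\<Sum>k\<le>n. int ((n + k) choose (2 * k)) * 27 ^ k)"

lemma binom_sum_eq:
  assumes "n \<le> m"
  shows   "binom_sum n = (\<Sum>k\<le>m. int ((n + k) choose (2 * k)) * 27 ^ k)"
  unfolding binom_sum_def
  by (rule sum.mono_neutral_left) (use assms in \<open>auto simp: binomial_eq_0\<close>)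

text \<open>Pascal's rule applied twice: a second difference in the upper index lowers the lower
  index by 2.\<close>

lemma binom_second_difference:
  "((n + 2 + Suc k) choose (2 * Suc k)) + ((n + Suc k) choose (2 * Suc k)) =
     2 * ((n + 1 + Suc k) choose (2 * Suc k)) + ((n + 1 + k) choose (2 * k))"
  by (simp add: numeral_2_eq_2)

lemma binom_sum_rec: "binom_sum (n + 2) = 29 * binom_sum (n + 1) - binom_sum n"
proof -
  let ?c = "\<lambda>m k. int ((m + k) choose (2 * k)) * 27 ^ k"
  have "binom_sum (n + 2) + binom_sum n - 2 * binom_sum (n + 1) =
      (\<Sum>k\<le>n + 2. ?c (n + 2) k + ?c n k - 2 * ?c (n + 1) k)"
    by (simp only: binom_sum_eq[of _ "n + 2"] sum.distrib sum_subtractf sum_distrib_left le_add1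
      add_le_cancel_left one_le_numeral order_refl)
  also have "\<dots> = (\<Sum>k\<le>Suc (n + 1). ?c (n + 2) k + ?c n k - 2 * ?c (n + 1) k)" by simp
  also have "\<dots> = (\<Sum>k\<le>n + 1. ?c (n + 2) (Suc k) + ?c n (Suc k) - 2 * ?c (n + 1) (Suc k))"
    by (subst sum.atMost_Suc_shift) simp
  also have "\<dots> = (\<Sum>k\<le>n + 1. 27 * ?c (n + 1) k)"
  proof (rule sum.cong[OF refl])
    fix k
    have "int ((n + 2 + Suc k) choose (2 * Suc k)) + int ((n + Suc k) choose (2 * Suc k)) =
        2 * int ((n + 1 + Suc k) choose (2 * Suc k)) + int ((n + 1 + k) choose (2 * k))"
      using binom_second_difference[of n k] by linarith
    then have "(int ((n + 2 + Suc k) choose (2 * Suc k)) + int ((n + Suc k) choose (2 * Suc k))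
        - 2 * int ((n + 1 + Suc k) choose (2 * Suc k))) * 27 ^ Suc k = int ((n + 1 + k) choose (2 * k)) * 27 ^ Suc k"
      by simp
    then show "?c (n + 2) (Suc k) + ?c n (Suc k) - 2 * ?c (n + 1) (Suc k) = 27 * ?c (n + 1) k"
      by (simp only: algebra_simps power_Suc)
  qed
  also have "\<dots> = 27 * binom_sum (n + 1)" by (simp only: binom_sum_def sum_distrib_left)
  finally show ?thesis by simp
qed

text \<open>The binomial times (2k)! is the product of the integers from n - k + 1 to n + k; the
  step adds one factor at each end.\<close>

lemma binom_fact_step:
  assumes "k < n"
  shows "((n + Suc k) choose (2 * Suc k)) * fact (2 * Suc k) =
    (n + Suc k) * (n - k) * (((n + k) choose (2 * k)) * fact (2 * k))"
proof -
  have 1: "fact (2 * k) * fact (n - k) * ((n + k) choose (2 * k)) = fact (n + k)"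
    using binomial_fact_lemma[of "2 * k" "n + k"] assms by simp
  have 2: "fact (2 * Suc k) * fact (n - Suc k) * ((n + Suc k) choose (2 * Suc k)) = fact (n + Suc k)"
    using binomial_fact_lemma[of "2 * Suc k" "n + Suc k"] assms by simp
  have 3: "n - k = Suc (n - Suc k)" using assms by simp
  then have 4: "fact (n - k) = (n - k) * fact (n - Suc k)" by (metis fact_Suc of_nat_id)
  have "fact (n - Suc k) * (((n + Suc k) choose (2 * Suc k)) * fact (2 * Suc k)) = fact (n + Suc k)"
    using 2 by (simp only: mult_ac)
  also have "\<dots> = (n + Suc k) * fact (n + k)" by simp
  also have "\<dots> = (n + Suc k) * (fact (2 * k) * ((n - k) * fact (n - Suc k)) * ((n + k) choose (2 * k)))"
    by (simp only: 1 [symmetric] 4)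
  also have "\<dots> = fact (n - Suc k) * ((n + Suc k) * (n - k) * (((n + k) choose (2 * k)) * fact (2 * k)))"
    by (simp only: mult_ac)
  finally show ?thesis by (simp del: fact_Suc mult_Suc_right binomial_Suc_Suc)
qed

text \<open>Both \<open>n = (p - 1)/3\<close> and \<open>n = (p - 2)/3\<close> satisfy \<open>9n(n + 1) \<equiv> -2\<close>, whence
  \<open>9(n + k + 1)(n - k) \<equiv> -(3k + 1)(3k + 2)\<close> modulo \<open>p\<close>.\<close>

lemma binom_term_cong:
  assumes p: "prime p" "p > 3" and k: "k \<le> p div 3"
  shows "[int ((3 * k) choose k) * (- 1) ^ k = int ((p div 3 + k) choose (2 * k)) * 27 ^ k] (mod int p)"
proof -
  define n where "n = p div 3"
  have "p mod 3 \<noteq> 0"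
    using p by (auto simp: prime_nat_iff dvd_eq_mod_eq_0 [symmetric])
  then have "p = 3 * n + 1 \<or> p = 3 * n + 2" unfolding n_def by presburger
  then have n: "int p dvd 9 * int n * (int n + 1) + 2"
  proof
    assume "p = 3 * n + 1"
    then have "9 * int n * (int n + 1) + 2 = int p * (3 * int n + 2)" by (simp add: algebra_simps)
    then show ?thesis by simp
  next
    assume "p = 3 * n + 2"
    then have "9 * int n * (int n + 1) + 2 = int p * (3 * int n + 1)" by (simp add: algebra_simps)
    then show ?thesis by simp
  qed
  define C where "C = (\<lambda>k. int (((n + k) choose (2 * k)) * fact (2 * k)))"
  \<comment> \<open>The claim multiplied by k! (2k)!, so that the induction needs no division; these
    factorials are prime to p because 2k < p.\<close>
  have main: "[fact k * (27 ^ k * C k) = (- 1) ^ k * fact (3 * k)] (mod int p)" if "k \<le> n" for k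
    using that
  proof (induction k)
    case 0
    show ?case by (simp add: C_def)
  next
    case (Suc k)
    then have kn: "k < n" by simp
    have "C (Suc k) = int (n + Suc k) * int (n - k) * C k"
      unfolding C_def binom_fact_step[OF kn] by (simp only: of_nat_mult)
    then have C: "C (Suc k) = (int n + int k + 1) * (int n - int k) * C k"
      using kn by (simp add: of_nat_diff)
    have "9 * ((int n + int k + 1) * (int n - int k)) - (- ((3 * int k + 1) * (3 * int k + 2)))
        = 9 * int n * (int n + 1) + 2" by (simp add: algebra_simps)
    then have step: "[9 * ((int n + int k + 1) * (int n - int k)) = - ((3 * int k + 1) * (3 * int k + 2))] (mod int p)"
      using n by (simp add: cong_iff_dvd_diff)
    have "fact (Suc k) * (27 ^ Suc k * C (Suc k)) =
        3 * (int k + 1) * (9 * ((int n + int k + 1) * (int n - int k))) * (fact k * (27 ^ k * C k))"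
      unfolding C by (simp add: algebra_simps)
    also have "[\<dots> = 3 * (int k + 1) * (- ((3 * int k + 1) * (3 * int k + 2))) * ((- 1) ^ k * fact (3 * k))] (mod int p)"
      using Suc.IH kn by (intro cong_mult[OF cong_mult[OF cong_refl step]]) simp
    also have "3 * (int k + 1) * (- ((3 * int k + 1) * (3 * int k + 2))) * ((- 1) ^ k * fact (3 * k)) =
        (- 1) ^ Suc k * ((3 * int k + 3) * ((3 * int k + 2) * ((3 * int k + 1) * fact (3 * k))))"
      by (simp add: algebra_simps)
    also have "(3 * int k + 3) * ((3 * int k + 2) * ((3 * int k + 1) * fact (3 * k))) = fact (3 * Suc k)"
    proof -
      have "3 * Suc k = Suc (Suc (Suc (3 * k)))" by simp
      then have "(fact (3 * Suc k) :: int) = fact (Suc (Suc (Suc (3 * k))))" by (rule arg_cong)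
      also have "\<dots> = (3 * int k + 3) * ((3 * int k + 2) * ((3 * int k + 1) * fact (3 * k)))"
        by (simp only: fact_Suc) (simp add: algebra_simps)
      finally show ?thesis by simp
    qed
    finally show ?case .
  qed
  have kn: "k \<le> n" using k by (simp add: n_def)
  have "fact k * fact (3 * k - k) * ((3 * k) choose k) = fact (3 * k)"
    by (rule binomial_fact_lemma) simp
  then have "fact k * fact (2 * k) * ((3 * k) choose k) = fact (3 * k)" by simp
  then have "int (fact k * fact (2 * k) * ((3 * k) choose k)) = int (fact (3 * k))" by (simp only:)
  then have f3: "fact (3 * k) = fact k * fact (2 * k) * int ((3 * k) choose k)" by simp
  have "[(fact k * fact (2 * k)) * (int ((n + k) choose (2 * k)) * 27 ^ k) =
      (fact k * fact (2 * k)) * (int ((3 * k) choose k) * (- 1) ^ k)] (mod int p)"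
    using main[OF kn] unfolding f3 C_def by (simp add: mult_ac)
  moreover have "coprime (fact k * fact (2 * k)) (int p)"
  proof -
    have "2 * k < p" "k < p" using k p(2) by auto
    then have "\<not> p dvd fact k" "\<not> p dvd fact (2 * k)"
      using p(1) by (simp_all add: prime_dvd_fact_iff)
    then have "coprime p (fact k * fact (2 * k))"
      using p(1) by (simp add: coprime_mult_right_iff prime_imp_coprime)
    then have "coprime (int p) (int (fact k * fact (2 * k)))" by (simp only: coprime_int_iff)
    then show ?thesis by (simp add: coprime_commute)
  qed
  ultimately have "[int ((n + k) choose (2 * k)) * 27 ^ k = int ((3 * k) choose k) * (- 1) ^ k] (mod int p)"
    by (simp only: cong_mult_lcancel)
  then show ?thesis unfolding n_def by (rule cong_sym)
qed

lemma binomial_sum_cong: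
  assumes "prime p" "p > 3"
  shows "[(\<Sum>k=0..p div 3. int ((3 * k) choose k) * (- 1) ^ k) = binom_sum (p div 3)] (mod int p)"
  unfolding binom_sum_def atLeast0AtMost
  by (intro cong_sum binom_term_cong assms) simp

text \<open>With t = z/w and t + 1/t = 29 the sequence is (t^(n+1/2) + t^(-n-1/2)) / (t^(1/2) +
  t^(-1/2)), with initial values 1 and 28. Clearing denominators and half powers gives this
  form.\<close>

lemma binom_sum_closed_form:
  fixes z w M d :: "'a :: comm_ring_1"
  assumes "z * w = M" "d dvd z\<^sup>2 + w\<^sup>2 - 29 * M"
  shows "d dvd of_int (binom_sum n) * M ^ n * (z + w) - (z ^ (2 * n + 1) + w ^ (2 * n + 1))"
proof (induction n rule: induct_nat_012)
  case 0
  show ?case by (simp add: binom_sum_def)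
next
  case 1
  have "binom_sum 1 = 28" by (simp add: binom_sum_def numeral_2_eq_2)
  then have "of_int (binom_sum 1) * M ^ 1 * (z + w) - (z ^ (2 * 1 + 1) + w ^ (2 * 1 + 1)) =
      - ((z\<^sup>2 + w\<^sup>2 - 29 * M) * (z + w)) + ((z\<^sup>2 + w\<^sup>2) * (z + w) - M * (z + w) - (z ^ 3 + w ^ 3))"
    by (simp add: algebra_simps numeral_3_eq_3)
  also have "(z\<^sup>2 + w\<^sup>2) * (z + w) - M * (z + w) - (z ^ 3 + w ^ 3) = 0"
    by (simp add: assms(1) [symmetric] algebra_simps power2_eq_square power3_eq_cube)
  finally show ?case using assms(2) by simp
next
  case (ge2 n)
  define t0 t1 :: 'a where "t0 = of_int (binom_sum n)" and "t1 = of_int (binom_sum (Suc n))"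
  have t2: "of_int (binom_sum (Suc (Suc n))) = 29 * t1 - t0"
    using binom_sum_rec[of n] by (simp add: t0_def t1_def)
  define D where "D = (\<lambda>n. z ^ (2 * n + 1) + w ^ (2 * n + 1))"
  have Drec: "D (Suc (Suc n)) = (z\<^sup>2 + w\<^sup>2) * D (Suc n) - M\<^sup>2 * D n"
    by (simp add: D_def assms(1) [symmetric] power2_eq_square algebra_simps)
  have "(29 * t1 - t0) * M ^ Suc (Suc n) * (z + w) - D (Suc (Suc n)) =
      29 * M * (t1 * M ^ Suc n * (z + w) - D (Suc n)) - M\<^sup>2 * (t0 * M ^ n * (z + w) - D n)
      - (z\<^sup>2 + w\<^sup>2 - 29 * M) * D (Suc n)"
    unfolding Drec by (simp add: algebra_simps power2_eq_square)
  moreover have "d dvd \<dots>"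
    using ge2 by (intro dvd_diff[OF dvd_diff[OF dvd_mult dvd_mult] dvd_mult2[OF assms(2)]])
      (simp_all only: t0_def t1_def D_def)
  ultimately show ?case by (simp only: t2 D_def)
qed

section \<open>Evaluation at primes represented by forms of discriminant \<open>-279\<close>\<close>

text \<open>In the closed form, reciprocity trades powers of \<open>z\<close> for powers of its
  conjugate, or conversely. A common power then cancels, leaving: the sum times the trace of
  \<open>z\<close> is the trace of \<open>u * z\<close>, with \<open>u\<close> the symbol of
  p.\<close>

lemma (in cubic_symbol) binom_sum_symbol:
  assumes p: "prime p" "p > 3" and cop: "coprime (int p) (eis_norm z)"
    and dvd: "of_int (int p) dvd z\<^sup>2 + (eis_cnj z)\<^sup>2 - 29 * of_int (eis_norm z)"
  shows "of_int (int p) dvd of_int (binom_sum (p div 3)) * (z + eis_cnj z)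
    - (f (int p) * z + eis_cnj (f (int p) * z))"
proof -
  define P :: eis where "P = of_int (int p)"
  define n where "n = p div 3"
  define T :: eis where "T = of_int (binom_sum n)"
  define w where "w = eis_cnj z"
  define u where "u = f (int p)"
  have u: "u * eis_cnj u = 1" unfolding u_def by (intro cube_roots_mult_cnj symbol_in cop)
  have R: "cubic_reciprocal p z u" unfolding u_def by (intro symbol_reciprocal p cop)
  have E: "P dvd T * (z * w) ^ n * (z + w) - (z ^ (2 * n + 1) + w ^ (2 * n + 1))"
    unfolding P_def T_def
    by (rule binom_sum_closed_form) (use dvd in \<open>simp_all add: w_def eis_mult_cnj\<close>)
  have double: "x ^ (2 * i) = x ^ i * x ^ i" "x ^ (2 * i + 1) = x ^ i * x ^ i * x" for x :: eis and i
    by (simp_all add: mult_2 power_add)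
  have cop_w: "coprime (int p) (eis_norm w)" using cop by (simp add: w_def)
  have cancel_w: "P dvd x" if "P dvd w ^ i * x" for i x
    using that
  proof (induction i)
    case (Suc i)
    then have "P dvd w * (w ^ i * x)" by (simp add: mult_ac)
    then show ?case using Suc.IH cop_w of_int_dvd_eis_mult_cancel unfolding P_def by blast
  qed simp
  have "P dvd T * u * (z + w) - u\<^sup>2 * z - w"
  proof -
    have "p mod 3 \<noteq> 0"
      using p by (auto simp: prime_nat_iff dvd_eq_mod_eq_0 [symmetric])
    then consider "p mod 3 = 1" | "p mod 3 = 2" by linarith
    then show ?thesis
    proof cases
      case 1
      then have R': "P dvd z ^ n - u * w ^ n"
        using R by (simp add: cubic_reciprocal_def n_def w_def P_def)
      have "w ^ (2 * n) * (T * u * (z + w) - u\<^sup>2 * z - w) =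
          (T * (z * w) ^ n * (z + w) - (z ^ (2 * n + 1) + w ^ (2 * n + 1)))
          - (z ^ n - u * w ^ n) * (T * w ^ n * (z + w))
          + (z ^ n - u * w ^ n) * ((z ^ n + u * w ^ n) * z)"
        unfolding double by (simp add: algebra_simps power2_eq_square power_mult_distrib)
      also have "P dvd \<dots>"
        by (rule dvd_add[OF dvd_diff[OF E dvd_mult2[OF R']] dvd_mult2[OF R']])
      finally show ?thesis by (rule cancel_w)
    next
      case 2
      define m where "m = Suc n"
      have R': "P dvd w ^ m - u * z ^ m"
        using R 2 by (simp add: cubic_reciprocal_def n_def m_def w_def P_def)
      have "z ^ (2 * m) * (T * u * (z + w) - u\<^sup>2 * z - w) =
          (T * (z * w) ^ n * (z + w) - (z ^ (2 * n + 1) + w ^ (2 * n + 1))) * (z * w)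
          - (w ^ m - u * z ^ m) * (T * z ^ m * (z + w))
          + (w ^ m - u * z ^ m) * ((w ^ m + u * z ^ m) * z)"
        unfolding double by (simp add: algebra_simps power2_eq_square power_mult_distrib m_def)
      also have "P dvd \<dots>"
        by (rule dvd_add[OF dvd_diff[OF dvd_mult2[OF E] dvd_mult2[OF R']] dvd_mult2[OF R']])
      finally show ?thesis unfolding P_def using cop by (rule symbol_cancel)
    qed
  qed
  then have "P dvd eis_cnj u * (T * u * (z + w) - u\<^sup>2 * z - w)" by (rule dvd_mult)
  also have "eis_cnj u * (T * u * (z + w) - u\<^sup>2 * z - w) =
      (u * eis_cnj u) * (T * (z + w) - u * z) - eis_cnj u * w"
    by (simp add: algebra_simps power2_eq_square)
  finally have "P dvd T * (z + w) - u * z - eis_cnj u * w" by (simp only: u mult_1_left)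
  then show ?thesis
    by (simp only: P_def T_def u_def w_def n_def eis_cnj_simps diff_diff_eq)
qed

text \<open>The rational factor \<open>c\<close> enters \<open>z\<close> and its conjugate alike and
  is prime to \<open>l\<close>, so it drops out of the quotient.\<close>

lemma (in cubic_symbol) symbol_reciprocal_reduce:
  assumes l: "prime l" and cop: "coprime (int l) (eis_norm z)" and dvd: "of_int (int l) dvd z - of_int c * y"
  shows "cubic_reciprocal l y (f (int l))"
proof -
  define L :: eis where "L = of_int (int l)"
  define u where "u = f (int l)"
  have R: "cubic_reciprocal l z u" unfolding u_def by (intro symbol_reciprocal l cop)
  have dvd1: "L dvd z - of_int c * y" using dvd by (simp only: L_def)
  have "L dvd eis_cnj (z - of_int c * y)" unfolding L_def of_int_dvd_eis_cnj_iff by (rule dvd)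
  then have dvd2: "L dvd eis_cnj z - of_int c * eis_cnj y" by simp
  have pow: "L dvd x ^ m - of_int (c ^ m) * x' ^ m" if "L dvd x - of_int c * x'" for x x' :: eis and m
  proof -
    have "x - of_int c * x' dvd x ^ m - (of_int c * x') ^ m" by (simp add: power_diff_sumr2)
    with that have "L dvd x ^ m - (of_int c * x') ^ m" by (rule dvd_trans)
    then show ?thesis by (simp add: power_mult_distrib)
  qed
  have "\<not> int l dvd c"
  proof
    assume "int l dvd c"
    then have "L dvd of_int c * y" unfolding L_def by (intro dvd_mult2) (simp only: of_int_dvd_of_int_eis_iff)
    from dvd_add[OF dvd1 this] have "L dvd z" by simp
    then have "L dvd z * eis_cnj z" by (rule dvd_mult2)
    then have "int l dvd eis_norm z" unfolding L_def eis_mult_cnj by (simp only: of_int_dvd_of_int_eis_iff)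
    with cop have "is_unit (int l)" by (metis coprime_common_divisor dvd_refl)
    then show False using l by auto
  qed
  then have "coprime (int l) c" using l by (intro prime_imp_coprime) simp_all
  then have "coprime (int l) (eis_norm (of_int (c ^ m)))" for m
    unfolding eis_norm_of_int by simp
  then have cancel: "L dvd x" if "L dvd of_int (c ^ m) * x" for m x
    using that of_int_dvd_eis_mult_cancel unfolding L_def by blast
  have reduce: "L dvd y1 ^ m - u * y2 ^ m"
    if "L dvd x1 ^ m - u * x2 ^ m" "L dvd x1 - of_int c * y1" "L dvd x2 - of_int c * y2" for x1 x2 y1 y2 m
  proof (rule cancel)
    have "of_int (c ^ m) * (y1 ^ m - u * y2 ^ m) = (x1 ^ m - u * x2 ^ m)
        - (x1 ^ m - of_int (c ^ m) * y1 ^ m) + u * (x2 ^ m - of_int (c ^ m) * y2 ^ m)"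
      by (simp add: algebra_simps)
    also have "L dvd \<dots>"
      by (rule dvd_add[OF dvd_diff[OF that(1) pow[OF that(2)]] dvd_mult[OF pow[OF that(3)]]])
    finally show "L dvd of_int (c ^ m) * (y1 ^ m - u * y2 ^ m)" .
  qed
  show ?thesis
    using R reduce[OF _ dvd1 dvd2] reduce[OF _ dvd2 dvd1]
    unfolding cubic_reciprocal_def L_def [symmetric] u_def [symmetric] by blast
qed

text \<open>If \<open>p\<close> did not divide \<open>a\<close>, it would divide x as well as y, so
  p^2 would divide the value p of the form.\<close>

lemma prime_dvd_form_trivial:
  fixes p x y a b c :: int
  assumes "prime p" "p = a * x\<^sup>2 + b * x * y + c * y\<^sup>2" "p dvd y"
  shows   "p dvd a"
proof (rule ccontr)
  assume na: "\<not> p dvd a"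
  have "p dvd p - (b * x + c * y) * y" using assms(3) by (intro dvd_diff dvd_mult) simp_all
  also have "p - (b * x + c * y) * y = a * x\<^sup>2" using assms(2) by (simp add: algebra_simps power2_eq_square)
  finally have "p dvd x\<^sup>2" using na assms(1) by (simp add: prime_dvd_mult_iff)
  with assms(1) have "p dvd x" by (rule prime_dvd_power)
  with assms(3) obtain x' y' where xy: "x = p * x'" "y = p * y'" by (auto elim!: dvdE)
  have "a * (p * x')\<^sup>2 + b * (p * x') * (p * y') + c * (p * y')\<^sup>2
      = p * (p * (a * x'\<^sup>2 + b * x' * y' + c * y'\<^sup>2))"
    by (simp add: algebra_simps power2_eq_square)
  with assms(2) have "p * 1 = p * (p * (a * x'\<^sup>2 + b * x' * y' + c * y'\<^sup>2))"
    unfolding xy mult_1_right by (rule trans)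
  then have "1 = p * (a * x'\<^sup>2 + b * x' * y' + c * y'\<^sup>2)"
    using assms(1) by (subst (asm) mult_cancel_left) auto
  then have "p dvd 1" by (metis dvd_triv_left)
  then show False using assms(1) by auto
qed

text \<open>The form \<open>A X\<^sup>2 + (2h + 9) X Y + C Y\<^sup>2\<close> has discriminant \<open>-279\<close>. With
  \<open>z = A X + h Y - 9 Y \<omega>\<close> the norm of \<open>z\<close> is \<open>A p - 9 Y\<^sup>2\<close>, so that \<open>(A/z)\<^sub>3 (p/z)\<^sub>3 = (3Y/z)\<^sub>3\<^sup>2\<close>,
  and modulo \<open>p\<close> the quotient of \<open>z\<close> and its conjugate is the unit \<open>(29 + 3 \<surd>93)/2\<close> that governs
  the recurrence of \<^const>\<open>binom_sum\<close>.\<close>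

lemma cubic_symbol_of_form:
  fixes A X Y h C :: int and p :: nat
  assumes p: "prime p" "p > 3" and form: "int p = A * X\<^sup>2 + (2 * h + 9) * X * Y + C * Y\<^sup>2"
    and disc: "A * C = h\<^sup>2 + 9 * h + 90" and A: "\<not> 3 dvd A" "\<not> int p dvd A"
  obtains f where "\<And>m n. f (m * n) = f m * f n" "f 1 = 1" "f A * f (int p) = 1"
    and "\<And>l. prime l \<Longrightarrow> int l dvd A \<Longrightarrow> f (int l) \<in> cube_roots \<and> cubic_reciprocal l (Eis h (- 9)) (f (int l))"
    and "\<And>u a b. f (int p) = u \<Longrightarrow> u * Eis (A * X + h * Y) (- 9 * Y) = Eis a b \<Longrightarrow>
      int p dvd binom_sum (p div 3) * (2 * A * X + (2 * h + 9) * Y) - (2 * a - b)"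
proof -
  define a where "a = A * X + h * Y"
  define z where "z = Eis a (- 9 * Y)"
  have z: "eis_fst z = a" "eis_snd z = - 9 * Y" by (simp_all add: z_def)
  have pp: "prime (int p)" "int p > 3" using p by auto
  have norm: "eis_norm z = A * int p - 9 * Y\<^sup>2"
  proof -
    have "eis_norm z = A * (A * X\<^sup>2 + (2 * h + 9) * X * Y) + (h\<^sup>2 + 9 * h + 90) * Y\<^sup>2 - 9 * Y\<^sup>2"
      unfolding eis_norm_def z a_def by (simp add: power2_eq_square algebra_simps)
    then show ?thesis unfolding disc [symmetric] form by (simp add: algebra_simps)
  qed
  \<comment> \<open>A common prime of Y and A divides p by the form, so every common prime equals p;
    then p divides Y and hence A.\<close>
  have copY: "coprime Y (A * int p)"
  proof (rule ccontr)
    assume "\<not> coprime Y (A * int p)"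
    then obtain c where c: "c dvd Y" "c dvd A * int p" "\<not> is_unit c" by (rule not_coprimeE)
    then obtain d where "prime d" "d dvd c" using prime_factor_int[of c] by auto
    with c have d: "prime d" "d dvd Y" "d dvd A * int p" using dvd_trans by blast+
    have "d dvd A \<or> d dvd int p" using d by (simp add: prime_dvd_mult_iff)
    then have "d dvd int p"
      using d(2) form by (auto simp: algebra_simps)
    then have "d = int p" using d(1) pp(1) by (simp add: primes_dvd_imp_eq)
    then have "int p dvd Y" using d(2) by simp
    with pp(1) form have "int p dvd A" by (rule prime_dvd_form_trivial)
    then show False using A(2) by contradiction
  qed
  have p3: "\<not> 3 dvd int p"
  proof
    assume "3 dvd int p"
    then have "(3 :: int) = int p" using pp(1) by (intro primes_dvd_imp_eq) simp_all
    then show False using pp(2) by simp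
  qed
  have "prime (3 :: int)" by simp
  then have cop3: "coprime (3 :: int) (A * int p)"
    using A(1) p3 prime_imp_coprime[of "3 :: int"] by (simp add: coprime_mult_right_iff)
  have cop3Y: "coprime (3 * Y) (eis_norm z)"
  proof -
    have "coprime (3 * Y) (A * int p)" using cop3 copY by (simp add: coprime_mult_left_iff)
    moreover have "[A * int p = eis_norm z] (mod 3 * Y)"
      unfolding norm cong_iff_dvd_diff by (simp add: power2_eq_square)
    ultimately show ?thesis by (metis cong_imp_coprime coprime_commute)
  qed
  have copAp: "coprime (A * int p) (eis_norm z)"
  proof -
    have "coprime (A * int p) (- (9 * Y\<^sup>2))"
      using cop3 copY coprime_mult_left_iff[of 3 3 "A * int p"] by (simp add: coprime_commute coprime_mult_right_iff)
    moreover have "[- (9 * Y\<^sup>2) = eis_norm z] (mod A * int p)"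
      unfolding norm cong_iff_dvd_diff by simp
    ultimately show ?thesis by (metis cong_imp_coprime coprime_commute)
  qed
  have a3: "\<not> 3 dvd a"
  proof
    assume "3 dvd a"
    then have "3 dvd eis_norm z" unfolding eis_norm_def z by (auto simp: power2_eq_square)
    with cop3Y have "(3 :: int) dvd 1" by (metis coprime_def dvd_triv_left)
    then show False by simp
  qed
  have "3 dvd eis_snd z" "\<not> 3 dvd eis_fst z" using a3 by (simp_all add: z)
  then obtain f where f: "is_cubic_symbol z f" using cubic_symbol_exists by blast
  interpret cubic_symbol z f by unfold_locales (fact f)
  have "3 * (eis_snd z)\<^sup>2 = 3 * (3 * (3 * (3 * 3))) * (Y * Y)" by (simp add: z power2_eq_square)
  then have "coprime (3 * (eis_snd z)\<^sup>2) (eis_norm z)"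
    using cop3Y by (simp only: coprime_mult_left_iff simp_thms)
  then have "f (3 * (eis_snd z)\<^sup>2) = 1"
    by (intro symbol_3_square) (use a3 in \<open>simp_all add: z\<close>)
  \<comment> \<open>The second coordinate is -9 Y, and 3 * 81 = 27 * 9; the cube 27 contributes
    1.\<close>
  then have "f (3 ^ 3 * (3 * Y)\<^sup>2) = 1" by (simp add: z power_mult_distrib)
  moreover have "f 3 ^ 3 = 1"
    using cop3Y by (intro cube_roots_cubed symbol_in) (simp add: coprime_mult_left_iff)
  ultimately have 1: "f ((3 * Y)\<^sup>2) = 1" by (simp only: symbol_mult symbol_power) simp
  have "f (A * int p) = f ((3 * Y)\<^sup>2)"
    by (rule symbol_cong) (simp add: norm cong_iff_dvd_diff power_mult_distrib)
  with 1 have 2: "f A * f (int p) = 1" by (simp add: symbol_mult)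
  have tr: "z + eis_cnj z = of_int (2 * A * X + (2 * h + 9) * Y)"
    by (simp add: eis_eq_iff z a_def algebra_simps)
  have "z\<^sup>2 + (eis_cnj z)\<^sup>2 - 29 * of_int (eis_norm z) = (z + eis_cnj z)\<^sup>2 - of_int (31 * eis_norm z)"
    by (simp add: power2_eq_square algebra_simps eis_mult_cnj [symmetric])
  also have "\<dots> = of_int ((2 * a + 9 * Y)\<^sup>2 - 31 * eis_norm z)"
    by (simp add: eis_eq_iff z power2_eq_square algebra_simps)
  \<comment> \<open>The constant 29 makes the combination proportional to
    \<open>eis_norm z + 9 * Y^2\<close>, which is \<open>A * p\<close>.\<close>
  also have "(2 * a + 9 * Y)\<^sup>2 - 31 * eis_norm z = - 27 * (eis_norm z + 9 * Y\<^sup>2)"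
    by (simp add: eis_norm_def z power2_eq_square algebra_simps)
  also have "of_int \<dots> = (of_int (int p * (- 27 * A)) :: eis)" by (simp add: norm)
  finally have "of_int (int p) dvd z\<^sup>2 + (eis_cnj z)\<^sup>2 - 29 * of_int (eis_norm z)"
    by (simp only: of_int_mult dvd_triv_left)
  then have 3: "of_int (int p) dvd of_int (binom_sum (p div 3)) * (z + eis_cnj z)
      - (f (int p) * z + eis_cnj (f (int p) * z))"
    using p copAp by (intro binom_sum_symbol) (simp_all add: coprime_mult_left_iff)
  show ?thesis
  proof (rule that)
    fix l assume l: "prime l" "int l dvd A"
    then have "coprime (int l) (eis_norm z)"
      using copAp coprime_divisors[of "int l" A "eis_norm z" "eis_norm z"] by (simp add: coprime_mult_left_iff)
    moreover have "of_int (int l) dvd z - of_int Y * Eis h (- 9)"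
      unfolding of_int_dvd_eis_iff using l(2) by (simp add: z a_def mult.commute[of Y h])
    ultimately show "f (int l) \<in> cube_roots \<and> cubic_reciprocal l (Eis h (- 9)) (f (int l))"
      using l(1) symbol_in symbol_reciprocal_reduce by blast
  next
    fix u a' b' assume u: "f (int p) = u" "u * Eis (A * X + h * Y) (- 9 * Y) = Eis a' b'"
    then have "of_int (int p) dvd of_int (binom_sum (p div 3)) * of_int (2 * A * X + (2 * h + 9) * Y)
        - (Eis a' b' + eis_cnj (Eis a' b'))"
      using 3 unfolding tr by (simp only: z_def a_def)
    then show "int p dvd binom_sum (p div 3) * (2 * A * X + (2 * h + 9) * Y) - (2 * a' - b')"
      unfolding of_int_dvd_eis_iff by simp
  qed (use 2 symbol_mult symbol_1 in auto)
qed

section \<open>Symbol values at 2, 5 and 7, and elementary tools for the final cases\<close>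

lemma cube_root_cases: "u \<in> cube_roots \<Longrightarrow> u = Eis 1 0 \<or> u = Eis 0 1 \<or> u = Eis (- 1) (- 1)"
  by (auto simp: cube_roots_def eis_eq_iff power2_eq_square)

text \<open>For even \<open>h\<close>, \<open>h - 9 omega\<close> is omega modulo 2 and its
  conjugate is omega^2, so omega is the only root that fits. The primes 5 and 7 need the same finite
  check with squares.\<close>

lemma cubic_reciprocal_2:
  assumes "u \<in> cube_roots" "cubic_reciprocal 2 (Eis h (- 9)) u" "even h"
  shows   "u = Eis 0 1"
  using cube_root_cases[OF assms(1)] assms(2,3)
  unfolding cubic_reciprocal_def of_int_dvd_eis_iff by auto

lemma cubic_reciprocal_5:
  assumes "u \<in> cube_roots" "cubic_reciprocal 5 (Eis h (- 9)) u"
  shows   "h = 0 \<Longrightarrow> u = Eis (- 1) (- 1)" "h = - 4 \<Longrightarrow> u = Eis 0 1"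
  using cube_root_cases[OF assms(1)] assms(2)
  unfolding cubic_reciprocal_def of_int_dvd_eis_iff by (auto simp: power2_eq_square)

lemma cubic_reciprocal_7:
  assumes "u \<in> cube_roots" "cubic_reciprocal 7 (Eis (- 4) (- 9)) u"
  shows   "u = Eis 0 1"
  using cube_root_cases[OF assms(1)] assms(2)
  unfolding cubic_reciprocal_def of_int_dvd_eis_iff by (auto simp: power2_eq_square)

lemma prime_dvd_numeral_cases:
  fixes p :: int
  assumes "prime p" "p > 3"
  shows "\<not> p dvd 1" "\<not> p dvd 2" "\<not> p dvd 4" "\<not> p dvd 8"
    "p dvd 10 \<Longrightarrow> p = 5" "p dvd 5 \<Longrightarrow> p = 5" "p dvd 7 \<Longrightarrow> p = 7" "p dvd 19 \<Longrightarrow> p = 19"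
    "p dvd 35 \<Longrightarrow> p = 5 \<or> p = 7" "p dvd 31 \<Longrightarrow> p = 31"
proof -
  have *: "p = q" if "prime q" "p dvd q" for q using that assms(1) by (simp add: primes_dvd_imp_eq)
  have 5: "prime (5 :: int)" "prime (7 :: int)" "prime (19 :: int)" "prime (31 :: int)" by simp_all
  show 1: "\<not> p dvd 1" using assms by auto
  show 2: "\<not> p dvd 2" using assms by (auto dest: zdvd_imp_le)
  have "p dvd 2 * 2 \<longleftrightarrow> p dvd 2" "p dvd 2 * (2 * 2) \<longleftrightarrow> p dvd 2" "p dvd 2 * 5 \<longleftrightarrow> p dvd 2 \<or> p dvd 5"
    "p dvd 5 * 7 \<longleftrightarrow> p dvd 5 \<or> p dvd 7"
    using assms(1) unfolding prime_dvd_mult_iff[OF assms(1)] by auto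
  then show "\<not> p dvd 4" "\<not> p dvd 8" "p dvd 10 \<Longrightarrow> p = 5" "p dvd 35 \<Longrightarrow> p = 5 \<or> p = 7"
    using 2 * 5 by auto
  show "p dvd 5 \<Longrightarrow> p = 5" "p dvd 7 \<Longrightarrow> p = 7" "p dvd 19 \<Longrightarrow> p = 19" "p dvd 31 \<Longrightarrow> p = 31"
    using * 5 by auto
qed

text \<open>\<open>S\<close> is known as \<open>t / U\<close>; equality with \<open>a / b\<close> is
  tested by cross-multiplication, which for a concrete form is a polynomial identity.\<close>

lemma cong_quotientI:
  assumes S: "p dvd S * U - t" and p: "prime p" and b: "\<not> p dvd b" and U: "\<not> p dvd U" and t: "p dvd t * b - a * U"
  shows "cong_quotient S a b p"
proof -
  have "p dvd (S * U - t) * b + (t * b - a * U)" using S t by (intro dvd_add dvd_mult2)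
  then have "p dvd U * (S * b - a)" by (simp add: algebra_simps)
  then have "p dvd S * b - a" using p U by (simp add: prime_dvd_mult_iff)
  then have 1: "[S * b = a] (mod p)" by (simp add: cong_iff_dvd_diff)
  have cop: "coprime b p" using p b by (metis coprime_commute prime_imp_coprime)
  have "[S * 1 = S * (b * modular_inverse p b)] (mod p)"
    using cop by (intro cong_mult cong_refl cong_sym[OF cong_modular_inverse1]) (simp_all add: coprime_commute)
  also have "S * (b * modular_inverse p b) = (S * b) * modular_inverse p b" by (simp add: mult_ac)
  also have "[(S * b) * modular_inverse p b = a * modular_inverse p b] (mod p)"
    using 1 by (intro cong_mult cong_refl)
  finally show ?thesis using cop by (simp add: cong_quotient_def)
qed

text \<open>4 A p minus the square of this partial derivative in X is 279 Y^2. As p is neither 3 nor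
  31, divisibility would pass to Y and then to A.\<close>

lemma not_dvd_form_derivative:
  fixes p A X Y h C :: int
  assumes p: "prime p" "p > 3" "p \<noteq> 31" and form: "p = A * X\<^sup>2 + (2 * h + 9) * X * Y + C * Y\<^sup>2"
    and disc: "A * C = h\<^sup>2 + 9 * h + 90" and A: "\<not> p dvd A"
  shows "\<not> p dvd 2 * A * X + (2 * h + 9) * Y"
proof
  assume U: "p dvd 2 * A * X + (2 * h + 9) * Y"
  have "4 * A * (A * X\<^sup>2 + (2 * h + 9) * X * Y + C * Y\<^sup>2) - (2 * A * X + (2 * h + 9) * Y) * (2 * A * X + (2 * h + 9) * Y)
      = (4 * (A * C) - (2 * h + 9)\<^sup>2) * Y\<^sup>2"
    by (simp add: algebra_simps power2_eq_square)
  also have "4 * (A * C) - (2 * h + 9)\<^sup>2 = 3 * (3 * 31)"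
    unfolding disc by (simp add: algebra_simps power2_eq_square)
  finally have "4 * A * p - (2 * A * X + (2 * h + 9) * Y) * (2 * A * X + (2 * h + 9) * Y) = 3 * (3 * 31) * Y\<^sup>2"
    unfolding form [symmetric] .
  moreover have "p dvd 4 * A * p - (2 * A * X + (2 * h + 9) * Y) * (2 * A * X + (2 * h + 9) * Y)"
    using U by (intro dvd_diff dvd_mult) simp_all
  ultimately have "p dvd 3 * (3 * 31) * Y\<^sup>2" by metis
  then have "p dvd 3 \<or> p dvd 31 \<or> p dvd Y\<^sup>2" using p(1) by (auto simp only: prime_dvd_mult_iff)
  moreover have "\<not> p dvd 3" using p(2) by (auto dest: zdvd_imp_le)
  ultimately have "p dvd Y\<^sup>2" using p prime_dvd_numeral_cases(10) by blast
  with p(1) have "p dvd Y" by (rule prime_dvd_power)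
  with p(1) form have "p dvd A" by (rule prime_dvd_form_trivial)
  then show False using A by contradiction
qed

text \<open>The cubic symbol \<open>f\<close> modulo \<open>z\<close> is determined at the primes dividing \<open>A\<close>, because modulo those
  \<open>z\<close> is a rational multiple of \<open>h - 9 \<omega>\<close>. So \<open>u\<close> below is the symbol of \<open>p\<close>.\<close>

lemma binomial_sum_of_form:
  fixes A X Y h C S :: int and p :: nat
  assumes p: "prime p" "p > 3" "p \<noteq> 31" and S: "S = (\<Sum>k=0..p div 3. int ((3 * k) choose k) * (- 1) ^ k)"
    and form: "int p = A * X\<^sup>2 + (2 * h + 9) * X * Y + C * Y\<^sup>2"
    and disc: "A * C = h\<^sup>2 + 9 * h + 90" and A: "\<not> 3 dvd A" "\<not> int p dvd A"
    and u: "\<And>f. (\<And>m n. f (m * n) = f m * f n) \<Longrightarrow> f 1 = 1 \<Longrightarrow>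
      (\<And>l. prime l \<Longrightarrow> int l dvd A \<Longrightarrow> f (int l) \<in> cube_roots \<and> cubic_reciprocal l (Eis h (- 9)) (f (int l))) \<Longrightarrow>
      f A * u = 1"
    and ab: "u * Eis (A * X + h * Y) (- 9 * Y) = Eis a b"
  shows "int p dvd S * (2 * A * X + (2 * h + 9) * Y) - (2 * a - b)"
proof -
  define U where "U = 2 * A * X + (2 * h + 9) * Y"
  obtain f where f: "\<And>m n. f (m * n) = f m * f n" "f 1 = 1" "f A * f (int p) = 1"
    "\<And>l. prime l \<Longrightarrow> int l dvd A \<Longrightarrow> f (int l) \<in> cube_roots \<and> cubic_reciprocal l (Eis h (- 9)) (f (int l))"
    "\<And>u a b. f (int p) = u \<Longrightarrow> u * Eis (A * X + h * Y) (- 9 * Y) = Eis a b \<Longrightarrow>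
      int p dvd binom_sum (p div 3) * (2 * A * X + (2 * h + 9) * Y) - (2 * a - b)"
    using cubic_symbol_of_form[OF p(1,2) form disc A] by blast
  have "f A * u = 1" using f(1,2,4) by (rule u)
  with f(3) have "f A * f (int p) = f A * u" "f A \<noteq> 0" by auto
  then have "f (int p) = u" by simp
  note 1 = f(5)[OF this ab]
  have "int p dvd S - binom_sum (p div 3)"
    unfolding S using binomial_sum_cong[OF p(1,2)] by (simp only: cong_iff_dvd_diff)
  then have "int p dvd (S - binom_sum (p div 3)) * U" by (rule dvd_mult2)
  from dvd_add[OF this 1] show ?thesis unfolding U_def [symmetric] by (simp add: algebra_simps)
qed

text \<open>When the symbol of p is 1, the traces of \<open>z\<close> and \<open>u * z\<close>
  coincide and cancel.\<close>

lemma binomial_sum_of_form_eq_1: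
  fixes A X Y h C S :: int and p :: nat
  assumes p: "prime p" "p > 3" "p \<noteq> 31" and S: "S = (\<Sum>k=0..p div 3. int ((3 * k) choose k) * (- 1) ^ k)"
    and form: "int p = A * X\<^sup>2 + (2 * h + 9) * X * Y + C * Y\<^sup>2"
    and disc: "A * C = h\<^sup>2 + 9 * h + 90" and A: "\<not> 3 dvd A" "\<not> int p dvd A"
    and u: "\<And>f. (\<And>m n. f (m * n) = f m * f n) \<Longrightarrow> f 1 = 1 \<Longrightarrow>
      (\<And>l. prime l \<Longrightarrow> int l dvd A \<Longrightarrow> f (int l) \<in> cube_roots \<and> cubic_reciprocal l (Eis h (- 9)) (f (int l))) \<Longrightarrow>
      f A = 1"
  shows "[S = 1] (mod int p)"
proof -
  define U where "U = 2 * A * X + (2 * h + 9) * Y"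
  have pp: "prime (int p)" "int p > 3" "int p \<noteq> 31" using p by auto
  have "int p dvd S * U - (2 * (A * X + h * Y) - - 9 * Y)"
    unfolding U_def using p S form disc A
  proof (rule binomial_sum_of_form)
    show "1 * Eis (A * X + h * Y) (- 9 * Y) = Eis (A * X + h * Y) (- 9 * Y)" by simp
  qed (use u in auto)
  then have "int p dvd U * (S - 1)" by (simp add: U_def algebra_simps)
  moreover have "\<not> int p dvd U"
    unfolding U_def using pp form disc A(2) by (rule not_dvd_form_derivative)
  ultimately show ?thesis
    using pp(1) by (simp add: prime_dvd_mult_iff cong_iff_dvd_diff)
qed

theorem theorem3p9:
  fixes p :: nat and S :: int
  assumes "prime p" and "p > 3" and "Legendre (int p) 31 = 1"
  defines "S \<equiv> (\<Sum>k=0..p div 3. int ((3 * k) choose k) * (-1) ^ k)"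
  shows "\<forall>x y :: int.
     (int p = x\<^sup>2 + x * y + 70 * y\<^sup>2 \<or> int p = 9 * x\<^sup>2 + 9 * x * y + 10 * y\<^sup>2 \<or>
      int p = 8 * x\<^sup>2 + 3 * x * y + 9 * y\<^sup>2 \<longrightarrow> [S = 1] (mod int p)) \<and>
     (int p = 5 * x\<^sup>2 + x * y + 14 * y\<^sup>2 \<and> p \<noteq> 5 \<longrightarrow>
        cong_quotient S (15 * x - 14 * y) (31 * y) (int p)) \<and>
     (int p = 7 * x\<^sup>2 + x * y + 10 * y\<^sup>2 \<and> p \<noteq> 7 \<longrightarrow>
        cong_quotient S (21 * x - 14 * y) (31 * y) (int p)) \<and>
     (int p = 19 * x\<^sup>2 + 5 * x * y + 4 * y\<^sup>2 \<and> p \<noteq> 19 \<longrightarrow>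
        cong_quotient S (57 * x - 8 * y) (31 * y) (int p)) \<and>
     (int p = 35 * x\<^sup>2 + x * y + 2 * y\<^sup>2 \<longrightarrow>
        cong_quotient S (- (105 * x + 17 * y)) (31 * y) (int p))"
proof (intro allI conjI impI; (elim conjE disjE)?)
  fix x y :: int
  \<comment> \<open>The Legendre symbol of 31 modulo 31 is 0.\<close>
  have p31: "p \<noteq> 31" using assms(3) by (auto simp: Legendre_def cong_def)
  have S: "S = (\<Sum>k=0..p div 3. int ((3 * k) choose k) * (-1) ^ k)" by (simp only: S_def)
  have pp: "prime (int p)" "int p > 3" "int p \<noteq> 31" using assms(1,2) p31 by auto
  note np = prime_dvd_numeral_cases[OF pp(1,2)]
  note eval = binomial_sum_of_form[OF assms(1,2) p31 S]
  note eval_1 = binomial_sum_of_form_eq_1[OF assms(1,2) p31 S]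
  note not_dvd_U = not_dvd_form_derivative[OF pp]
  {
    assume "int p = x\<^sup>2 + x * y + 70 * y\<^sup>2"
    then have form: "int p = 1 * x\<^sup>2 + (2 * (- 4) + 9) * x * y + 70 * y\<^sup>2" by simp
    show "[S = 1] (mod int p)" by (rule eval_1[OF form]) (use np(1) in simp_all)
  next
    assume form: "int p = 9 * x\<^sup>2 + 9 * x * y + 10 * y\<^sup>2"
    \<comment> \<open>The variables are swapped because the leading coefficient must be prime to
      3.\<close>
    then have form': "int p = 10 * y\<^sup>2 + (2 * 0 + 9) * y * x + 9 * x\<^sup>2" by (simp add: algebra_simps)
    have "int p \<noteq> 5"
    proof
      assume p5: "int p = 5"
      \<comment> \<open>Completing the square: p = 5 gives 200 < 279 and forces x = 0.\<close>
      have "40 * int p = (20 * y + 9 * x)\<^sup>2 + 279 * x\<^sup>2"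
        unfolding form by (simp add: algebra_simps power2_eq_square)
      then have "279 * x\<^sup>2 \<le> 200" using p5 zero_le_power2[of "20 * y + 9 * x"] by linarith
      then have "x = 0" using zero_less_power2[of x] by linarith
      then have "5 = 10 * y\<^sup>2" using form p5 by simp
      then show False by presburger
    qed
    then have p10: "\<not> int p dvd 10" using np(5) by blast
    show "[S = 1] (mod int p)"
    proof (rule eval_1[OF form' _ _ p10])
      fix f :: "int \<Rightarrow> eis" assume f: "\<And>m n. f (m * n) = f m * f n"
        "\<And>l. prime l \<Longrightarrow> int l dvd 10 \<Longrightarrow> f (int l) \<in> cube_roots \<and> cubic_reciprocal l (Eis 0 (- 9)) (f (int l))"
      \<comment> \<open>The symbols omega at 2 and omega^2 at 5 are inverse, so the symbol of 10 is
        1.\<close>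
      have "f 2 = Eis 0 1" using f(2)[of 2] cubic_reciprocal_2[of "f 2" 0] by simp
      moreover have "f 5 = Eis (- 1) (- 1)" using f(2)[of 5] cubic_reciprocal_5(1)[of "f 5" 0] by simp
      moreover have "f 10 = f 2 * f 5" using f(1)[of 2 5] by simp
      ultimately show "f 10 = 1" by (simp add: times_eis_def one_eis_def)
    qed simp_all
  next
    assume "int p = 8 * x\<^sup>2 + 3 * x * y + 9 * y\<^sup>2"
    then have form': "int p = 8 * x\<^sup>2 + (2 * (- 3) + 9) * x * y + 9 * y\<^sup>2" by simp
    show "[S = 1] (mod int p)"
    proof (rule eval_1[OF form' _ _ np(4)])
      fix f :: "int \<Rightarrow> eis" assume f: "\<And>m n. f (m * n) = f m * f n"
        "\<And>l. prime l \<Longrightarrow> int l dvd 8 \<Longrightarrow> f (int l) \<in> cube_roots \<and> cubic_reciprocal l (Eis (- 3) (- 9)) (f (int l))"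
      \<comment> \<open>8 is a cube, so the value at 2 does not matter.\<close>
      have "f 8 = f 2 ^ 3" using f(1)[of 2 4] f(1)[of 2 2] by (simp add: power3_eq_cube mult_ac)
      also have "\<dots> = 1" using f(2)[of 2] by (intro cube_roots_cubed) simp
      finally show "f 8 = 1" .
    qed simp_all
  next
    assume form: "int p = 5 * x\<^sup>2 + x * y + 14 * y\<^sup>2" and "p \<noteq> 5"
    then have form': "int p = 5 * x\<^sup>2 + (2 * (- 4) + 9) * x * y + 14 * y\<^sup>2" by simp
    have p5: "\<not> int p dvd 5" using np(6) \<open>p \<noteq> 5\<close> by auto
    \<comment> \<open>\<open>f 5\<close> is omega, so p has symbol omega^2. The entries are the
      coordinates of omega^2 times \<open>z\<close>, and the subtracted term is its trace.\<close>
    have "int p dvd S * (2 * 5 * x + (2 * (- 4) + 9) * y) - (2 * (- 5 * x - 5 * y) - (4 * y - 5 * x))"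
    proof (rule eval[OF form'])
      fix f :: "int \<Rightarrow> eis" assume f: "\<And>m n. f (m * n) = f m * f n"
        "\<And>l. prime l \<Longrightarrow> int l dvd 5 \<Longrightarrow> f (int l) \<in> cube_roots \<and> cubic_reciprocal l (Eis (- 4) (- 9)) (f (int l))"
      have "f 5 = Eis 0 1" using f(2)[of 5] cubic_reciprocal_5(2)[of "f 5" "- 4"] by simp
      then show "f 5 * Eis (- 1) (- 1) = 1" by (simp add: times_eis_def one_eis_def)
    next
      show "Eis (- 1) (- 1) * Eis (5 * x + - 4 * y) (- 9 * y) = Eis (- 5 * x - 5 * y) (4 * y - 5 * x)"
        by (simp add: times_eis_def)
    qed (use np p5 in simp_all)
    then show "cong_quotient S (15 * x - 14 * y) (31 * y) (int p)"
    proof (rule cong_quotientI[OF _ pp(1)])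
      show "\<not> int p dvd 2 * 5 * x + (2 * (- 4) + 9) * y"
        by (rule not_dvd_U[OF form']) (use np p5 in simp_all)
      show "\<not> int p dvd 31 * y"
        using np(10) pp(3) p5 prime_dvd_form_trivial[OF pp(1) form'] prime_dvd_mult_iff[OF pp(1)] by blast
      \<comment> \<open>Cross-multiplying (-5x - 14y)/(10x + y) with the stated quotient leaves a
        multiple of the form, hence of p.\<close>
      have "(2 * (- 5 * x - 5 * y) - (4 * y - 5 * x)) * (31 * y) - (15 * x - 14 * y) * (2 * 5 * x + (2 * (- 4) + 9) * y) = int p * (- 30)"
        unfolding form by (simp add: algebra_simps power2_eq_square)
      then show "int p dvd (2 * (- 5 * x - 5 * y) - (4 * y - 5 * x)) * (31 * y) - (15 * x - 14 * y) * (2 * 5 * x + (2 * (- 4) + 9) * y)"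
        by (metis dvd_triv_left)
    qed
  next
    assume form: "int p = 7 * x\<^sup>2 + x * y + 10 * y\<^sup>2" and "p \<noteq> 7"
    then have form': "int p = 7 * x\<^sup>2 + (2 * (- 4) + 9) * x * y + 10 * y\<^sup>2" by simp
    have p7: "\<not> int p dvd 7" using np(7) \<open>p \<noteq> 7\<close> by auto
    have "int p dvd S * (2 * 7 * x + (2 * (- 4) + 9) * y) - (2 * (- 7 * x - 5 * y) - (4 * y - 7 * x))"
    proof (rule eval[OF form'])
      fix f :: "int \<Rightarrow> eis" assume f: "\<And>m n. f (m * n) = f m * f n"
        "\<And>l. prime l \<Longrightarrow> int l dvd 7 \<Longrightarrow> f (int l) \<in> cube_roots \<and> cubic_reciprocal l (Eis (- 4) (- 9)) (f (int l))"
      have "f 7 = Eis 0 1" using f(2)[of 7] cubic_reciprocal_7[of "f 7"] by simp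
      then show "f 7 * Eis (- 1) (- 1) = 1" by (simp add: times_eis_def one_eis_def)
    next
      show "Eis (- 1) (- 1) * Eis (7 * x + - 4 * y) (- 9 * y) = Eis (- 7 * x - 5 * y) (4 * y - 7 * x)"
        by (simp add: times_eis_def)
    qed (use np p7 in simp_all)
    then show "cong_quotient S (21 * x - 14 * y) (31 * y) (int p)"
    proof (rule cong_quotientI[OF _ pp(1)])
      show "\<not> int p dvd 2 * 7 * x + (2 * (- 4) + 9) * y"
        by (rule not_dvd_U[OF form']) (use np p7 in simp_all)
      show "\<not> int p dvd 31 * y"
        using np(10) pp(3) p7 prime_dvd_form_trivial[OF pp(1) form'] prime_dvd_mult_iff[OF pp(1)] by blast
      have "(2 * (- 7 * x - 5 * y) - (4 * y - 7 * x)) * (31 * y) - (21 * x - 14 * y) * (2 * 7 * x + (2 * (- 4) + 9) * y) = int p * (- 42)"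
        unfolding form by (simp add: algebra_simps power2_eq_square)
      then show "int p dvd (2 * (- 7 * x - 5 * y) - (4 * y - 7 * x)) * (31 * y) - (21 * x - 14 * y) * (2 * 7 * x + (2 * (- 4) + 9) * y)"
        by (metis dvd_triv_left)
    qed
  next
    assume form: "int p = 19 * x\<^sup>2 + 5 * x * y + 4 * y\<^sup>2" and "p \<noteq> 19"
    \<comment> \<open>Swapping the variables replaces 19 by 4, where only the symbol at 2 is
      needed.\<close>
    then have form': "int p = 4 * y\<^sup>2 + (2 * (- 2) + 9) * y * x + 19 * x\<^sup>2" by (simp add: algebra_simps)
    have p19: "\<not> int p dvd 19" using np(8) \<open>p \<noteq> 19\<close> by auto
    have "int p dvd S * (2 * 4 * y + (2 * (- 2) + 9) * x) - (2 * (9 * x) - (4 * y + 7 * x))"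
    proof (rule eval[OF form'])
      fix f :: "int \<Rightarrow> eis" assume f: "\<And>m n. f (m * n) = f m * f n"
        "\<And>l. prime l \<Longrightarrow> int l dvd 4 \<Longrightarrow> f (int l) \<in> cube_roots \<and> cubic_reciprocal l (Eis (- 2) (- 9)) (f (int l))"
      have "f 2 = Eis 0 1" using f(2)[of 2] cubic_reciprocal_2[of "f 2" "- 2"] by simp
      then have "f 4 = Eis (- 1) (- 1)" using f(1)[of 2 2] by (simp add: times_eis_def)
      then show "f 4 * Eis 0 1 = 1" by (simp add: times_eis_def one_eis_def)
    next
      show "Eis 0 1 * Eis (4 * y + - 2 * x) (- 9 * x) = Eis (9 * x) (4 * y + 7 * x)"
        by (simp add: times_eis_def)
    qed (use np p19 in simp_all)
    then show "cong_quotient S (57 * x - 8 * y) (31 * y) (int p)"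
    proof (rule cong_quotientI[OF _ pp(1)])
      show "\<not> int p dvd 2 * 4 * y + (2 * (- 2) + 9) * x"
        by (rule not_dvd_U[OF form']) (use np p19 in simp_all)
      show "\<not> int p dvd 31 * y"
        using np(10) pp(3) p19 prime_dvd_form_trivial[OF pp(1) form] prime_dvd_mult_iff[OF pp(1)] by blast
      have "(2 * (9 * x) - (4 * y + 7 * x)) * (31 * y) - (57 * x - 8 * y) * (2 * 4 * y + (2 * (- 2) + 9) * x) = int p * (- 15)"
        unfolding form by (simp add: algebra_simps power2_eq_square)
      then show "int p dvd (2 * (9 * x) - (4 * y + 7 * x)) * (31 * y) - (57 * x - 8 * y) * (2 * 4 * y + (2 * (- 2) + 9) * x)"
        by (metis dvd_triv_left)
    qed
  next
    assume form: "int p = 35 * x\<^sup>2 + x * y + 2 * y\<^sup>2"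
    then have form': "int p = 2 * y\<^sup>2 + (2 * (- 4) + 9) * y * x + 35 * x\<^sup>2" by (simp add: algebra_simps)
    from form have form1: "int p = 35 * x\<^sup>2 + 1 * x * y + 2 * y\<^sup>2" by simp
    \<comment> \<open>Needed for p not to divide y. The only candidates 5 and 7 give 8p < 279, hence
      x = 0 and p even.\<close>
    have p35: "\<not> int p dvd 35"
    proof
      assume "int p dvd 35"
      then have p57: "int p = 5 \<or> int p = 7" by (rule np(9))
      have "8 * int p = (4 * y + x)\<^sup>2 + 279 * x\<^sup>2"
        unfolding form by (simp add: algebra_simps power2_eq_square)
      then have "279 * x\<^sup>2 \<le> 56" using p57 zero_le_power2[of "4 * y + x"] by linarith
      then have "x = 0" using zero_less_power2[of x] by linarith
      then have "int p = 2 * y\<^sup>2" using form by simp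
      then show False using p57 by presburger
    qed
    have "int p dvd S * (2 * 2 * y + (2 * (- 4) + 9) * x) - (2 * (- 5 * x - 2 * y) - (4 * x - 2 * y))"
    proof (rule eval[OF form'])
      fix f :: "int \<Rightarrow> eis" assume f: "\<And>m n. f (m * n) = f m * f n"
        "\<And>l. prime l \<Longrightarrow> int l dvd 2 \<Longrightarrow> f (int l) \<in> cube_roots \<and> cubic_reciprocal l (Eis (- 4) (- 9)) (f (int l))"
      have "f 2 = Eis 0 1" using f(2)[of 2] cubic_reciprocal_2[of "f 2" "- 4"] by simp
      then show "f 2 * Eis (- 1) (- 1) = 1" by (simp add: times_eis_def one_eis_def)
    next
      show "Eis (- 1) (- 1) * Eis (2 * y + - 4 * x) (- 9 * x) = Eis (- 5 * x - 2 * y) (4 * x - 2 * y)"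
        by (simp add: times_eis_def)
    qed (use np p35 in simp_all)
    then show "cong_quotient S (- (105 * x + 17 * y)) (31 * y) (int p)"
    proof (rule cong_quotientI[OF _ pp(1)])
      show "\<not> int p dvd 2 * 2 * y + (2 * (- 4) + 9) * x"
        by (rule not_dvd_U[OF form']) (use np p35 in simp_all)
      show "\<not> int p dvd 31 * y"
        using np(10) pp(3) p35 prime_dvd_form_trivial[OF pp(1) form1] prime_dvd_mult_iff[OF pp(1)] by blast
      have "(2 * (- 5 * x - 2 * y) - (4 * x - 2 * y)) * (31 * y) - (- (105 * x + 17 * y)) * (2 * 2 * y + (2 * (- 4) + 9) * x) = int p * 3"
        unfolding form by (simp add: algebra_simps power2_eq_square)
      then show "int p dvd (2 * (- 5 * x - 2 * y) - (4 * x - 2 * y)) * (31 * y) - (- (105 * x + 17 * y)) * (2 * 2 * y + (2 * (- 4) + 9) * x)"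
        by (metis dvd_triv_left)
    qed
  }
qed

end
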